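(* There exist absolute constants $B_1,B_2$ such that the following holds. For every number of products $N\ge 1$, every feasible family $\mathcal{S}$ of assortments given by totally unimodular constraints and closed under taking subsets, all revenues $r_1,\dots,r_N\in[0,1]$, all MNL parameters $\mathbf{v}=(v_0,v_1,\dots,v_N)$ with $v_0=1$ and $v_i\le v_0=1$ for $i=1,\dots,N$, and every time $T\ge1$, the regret of the policy $\pi$ given by Algorithm 1 (described in the context) satisfies $$Reg_\pi(T,\mathbf{v})\le B_1\left(\frac{N^2\log T}{\Delta(\mathbf{v})}\right)+B_2,$$ where $\Delta(\mathbf{v})=\min\{R(S^*,\mathbf{v})-R(S,\mathbf{v}) : S\in\mathcal{S},\ R(S,\mathbf{v})\ne R(S^*,\mathbf{v})\}$ is the gap between the optimal and the second-best expected revenue.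
   Context: **MNL-Bandit problem.** There are $N$ products with known revenues $r_i$ and unknown attraction parameters $v_i>0$; $v_0=1$ is the parameter of the no-purchase option $0$. The feasible assortments are $\mathcal{S}=\{S\subseteq\{1,\dots,N\} : A\,\mathbf{x}(S)\le \mathbf{b}\}$, where $\mathbf{x}(S)\in\{0,1\}^N$ is the incidence vector of $S$, $A$ is a totally unimodular matrix and $\mathbf{b}$ is an integral vector; moreover $S\in\mathcal{S}$ and $Q\subseteq S$ imply $Q\in\mathcal{S}$. At each time $t$ the seller offers $S_t\in\mathcal{S}$ and observes $c_t\in S_t\cup\{0\}$, where, conditionally on $S_t=S$, $c_t$ is independent of the past and $\mathbb{P}(c_t=i\mid S_t=S)=v_i/(v_0+\sum_{j\in S}v_j)$ for $i\in S\cup\{0\}$. The expected revenue of $S$ is $R(S,\mathbf{v})=\sum_{i\in S} r_iv_i/(1+\sum_{j\in S}v_j)$. With $S^*\in\arg\max_{S\in\mathcal{S}}R(S,\mathbf{v})$, the regret of a policy $\pi$ is $Reg_\pi(T,\mathbf{v})=\sum_{t=1}^T \big(R(S^*,\mathbf{v})-\mathbb{E}_\pi[R(S_t,\mathbf{v})]\big)$, where $S_t$ is the assortment offered by $\pi$ at time $t$. If every feasible assortment is optimal, $\Delta(\mathbf v)=+\infty$ (and the regret is $0$). **Algorithm 1.** Put $v^{\sf UCB}_{i,0}=1$ for all $i$. Time is divided into consecutive epochs $\ell=1,2,\dots$. In epoch $\ell$ the assortment $$S_\ell\in\arg\max_{S\in\mathcal{S}}\tilde R_\ell(S),\qquad \tilde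 R_\ell(S)=\frac{\sum_{i\in S}r_iv^{\sf UCB}_{i,\ell-1}}{1+\sum_{j\in S}v^{\sf UCB}_{j,\ell-1}}$$ (ties broken by an arbitrary rule) is offered at every time step until, and including, the first time step at which a no-purchase occurs; $\mathcal{E}_\ell$ is the set of time steps of epoch $\ell$. At the end of epoch $\ell$ let $\hat v_{i,\ell}=\sum_{t\in\mathcal{E}_\ell}\mathbf{1}(c_t=i)$, $\mathcal{T}_i(\ell)=\{\tau\le\ell : i\in S_\tau\}$, $T_i(\ell)=|\mathcal{T}_i(\ell)|$, $\bar v_{i,\ell}=\frac1{T_i(\ell)}\sum_{\tau\in\mathcal{T}_i(\ell)}\hat v_{i,\tau}$, and $$v^{\sf UCB}_{i,\ell}=\bar v_{i,\ell}+\sqrt{\bar v_{i,\ell}\,\frac{48\log(\sqrt N\ell+1)}{T_i(\ell)}}+\frac{48\log(\sqrt N\ell+1)}{T_i(\ell)}$$ for every $i$ with $T_i(\ell)\ge1$; for products with $T_i(\ell)=0$ the value stays $v^{\sf UCB}_{i,\ell}=1$. The policy is run for the time steps $1,\dots,T$ (the last epoch may be truncated). *)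

theory Defs
  imports
    "HOL-Probability.Probability"
    "Jordan_Normal_Form.DL_Submatrix"
    "Jordan_Normal_Form.Determinant"
begin

text \<open>Products are the numbers \<open>1, \<dots>, N\<close>; \<open>0\<close> is the no-purchase option.  Matrix and vector
  positions start at \<open>0\<close>, so product \<open>i\<close> sits in column \<open>i - 1\<close>.\<close>

definition totally_unimodular :: "int mat \<Rightarrow> bool" where
  "totally_unimodular A \<longleftrightarrow>
     (\<forall>I J. I \<subseteq> {..<dim_row A} \<longrightarrow> J \<subseteq> {..<dim_col A} \<longrightarrow> card I = card J \<longrightarrow>
        Determinant.det (submatrix A I J) \<in> {-1, 0, 1})"

definition incidence_vec :: "nat \<Rightarrow> nat set \<Rightarrow> int Matrix.vec" where
  "incidence_vec N S = Matrix.vec N (\<lambda>k. if Suc k \<in> S then 1 else 0)"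

definition feasible :: "nat \<Rightarrow> int mat \<Rightarrow> int Matrix.vec \<Rightarrow> nat set set" where
  "feasible N A b = {S. S \<subseteq> {1..N} \<and> A *\<^sub>v incidence_vec N S \<le> b}"

definition revenue :: "(nat \<Rightarrow> real) \<Rightarrow> (nat \<Rightarrow> real) \<Rightarrow> nat set \<Rightarrow> real" where
  "revenue r v S = (\<Sum>i\<in>S. r i * v i) / (1 + (\<Sum>j\<in>S. v j))"

definition mnl_choice :: "(nat \<Rightarrow> real) \<Rightarrow> nat set \<Rightarrow> nat pmf" where
  "mnl_choice v S =
     embed_pmf (\<lambda>i. if i \<in> insert 0 S then v i / (v 0 + (\<Sum>j\<in>S. v j)) else 0)"

lemma pmf_mnl_choice:
  assumes "finite S" "0 \<notin> S" "v 0 > 0" "\<And>i. i \<in> S \<Longrightarrow> v i \<ge> 0"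
  shows "pmf (mnl_choice v S) i = (if i \<in> insert 0 S then v i / (v 0 + (\<Sum>j\<in>S. v j)) else 0)"
proof -
  define D where "D = v 0 + (\<Sum>j\<in>S. v j)"
  define f where "f = (\<lambda>i. if i \<in> insert 0 S then v i / D else 0)"
  have D: "D > 0"
    using assms by (auto simp: D_def intro!: add_pos_nonneg sum_nonneg)
  have nonneg: "f i \<ge> 0" for i
    using D assms by (auto simp: f_def)
  have "(\<integral>\<^sup>+ i. ennreal (f i) \<partial>count_space UNIV) = (\<Sum>i\<in>insert 0 S. ennreal (f i))"
    using assms(1) by (intro nn_integral_count_space') (auto simp: f_def)
  also have "\<dots> = ennreal (\<Sum>i\<in>insert 0 S. f i)"
    using nonneg by (simp add: sum_ennreal)
  also have "(\<Sum>i\<in>insert 0 S. f i) = (\<Sum>i\<in>insert 0 S. v i / D)"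
    by (intro sum.cong) (auto simp: f_def)
  also have "\<dots> = 1"
    using assms(1,2) D by (simp add: sum_divide_distrib[symmetric] add_divide_distrib[symmetric] D_def)
  finally have "pmf (embed_pmf f) i = f i"
    using nonneg by (intro pmf_embed_pmf) auto
  then show ?thesis
    unfolding mnl_choice_def f_def D_def .
qed

definition best_assortment ::
    "nat set set \<Rightarrow> (nat \<Rightarrow> real) \<Rightarrow> (nat \<Rightarrow> real) \<Rightarrow> nat set" where
  "best_assortment F r v = arg_max_on (revenue r v) F"

lemma best_assortment_is_arg_max:
  assumes "finite F" "F \<noteq> {}"
  shows "is_arg_max (revenue r v) (\<lambda>S. S \<in> F) (best_assortment F r v)"
proof -
  obtain S where S: "S \<in> F" "revenue r v S = Max (revenue r v ` F)"
    using Max_in[of "revenue r v ` F"] assms by fastforce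
  have "is_arg_max (revenue r v) (\<lambda>S. S \<in> F) S"
    using S assms(1) by (auto simp: is_arg_max_def not_less)
  then show ?thesis
    unfolding best_assortment_def arg_max_on_def arg_max_def by (rule someI)
qed

definition gap :: "nat set set \<Rightarrow> (nat \<Rightarrow> real) \<Rightarrow> (nat \<Rightarrow> real) \<Rightarrow> ereal" where
  "gap F r v =
     (let Rstar = revenue r v (best_assortment F r v);
          D = {Rstar - revenue r v S | S. S \<in> F \<and> revenue r v S \<noteq> Rstar}
      in if D = {} then \<infinity> else ereal (Min D))"

text \<open>A history lists the pairs (offered assortment, observed choice) in chronological order.
  A policy maps the history to the law of the next assortment.\<close>

type_synonym history = "(nat set \<times> nat) list"
type_synonym policy = "history \<Rightarrow> nat set pmf"

fun trajectory :: "(nat \<Rightarrow> real) \<Rightarrow> policy \<Rightarrow> nat \<Rightarrow> history pmf" where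
  "trajectory v \<pi> 0 = return_pmf []"
| "trajectory v \<pi> (Suc t) =
     bind_pmf (trajectory v \<pi> t) (\<lambda>h.
     bind_pmf (\<pi> h) (\<lambda>S.
     map_pmf (\<lambda>c. h @ [(S, c)]) (mnl_choice v S)))"

text \<open>Time steps are \<open>1, \<dots>, length h\<close>.\<close>

definition offered :: "history \<Rightarrow> nat \<Rightarrow> nat set" where
  "offered h t = fst (h ! (t - 1))"

definition chosen :: "history \<Rightarrow> nat \<Rightarrow> nat" where
  "chosen h t = snd (h ! (t - 1))"

definition regret ::
    "nat set set \<Rightarrow> (nat \<Rightarrow> real) \<Rightarrow> (nat \<Rightarrow> real) \<Rightarrow> policy \<Rightarrow> nat \<Rightarrow> real" where
  "regret F r v \<pi> T =
     (\<Sum>t=1..T. revenue r v (best_assortment F r v)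
        - measure_pmf.expectation (trajectory v \<pi> T) (\<lambda>h. revenue r v (offered h t)))"

definition completed_epochs :: "history \<Rightarrow> nat" where
  "completed_epochs h = card {s\<in>{1..length h}. chosen h s = 0}"

definition epoch_times :: "history \<Rightarrow> nat \<Rightarrow> nat set" where
  "epoch_times h l = {t\<in>{1..length h}. card {s\<in>{1..<t}. chosen h s = 0} + 1 = l}"

definition epoch_assortment :: "history \<Rightarrow> nat \<Rightarrow> nat set" where
  "epoch_assortment h l = offered h (Min (epoch_times h l))"

definition v_hat :: "history \<Rightarrow> nat \<Rightarrow> nat \<Rightarrow> real" where
  "v_hat h i l = (\<Sum>t\<in>epoch_times h l. of_bool (chosen h t = i))"

definition offer_epochs :: "history \<Rightarrow> nat \<Rightarrow> nat \<Rightarrow> nat set" where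
  "offer_epochs h i l = {\<tau>\<in>{1..l}. i \<in> epoch_assortment h \<tau>}"

definition offer_count :: "history \<Rightarrow> nat \<Rightarrow> nat \<Rightarrow> nat" where
  "offer_count h i l = card (offer_epochs h i l)"

definition v_bar :: "history \<Rightarrow> nat \<Rightarrow> nat \<Rightarrow> real" where
  "v_bar h i l = (\<Sum>\<tau>\<in>offer_epochs h i l. v_hat h i \<tau>) / offer_count h i l"

text \<open>The case \<open>l = 0\<close> (initial values) falls under \<open>offer_count h i l = 0\<close>.\<close>

definition v_ucb :: "nat \<Rightarrow> history \<Rightarrow> nat \<Rightarrow> nat \<Rightarrow> real" where
  "v_ucb N h l i =
     (if offer_count h i l = 0 then 1
      else v_bar h i l
         + sqrt (v_bar h i l * (48 * ln (sqrt N * l + 1) / offer_count h i l))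
         + 48 * ln (sqrt N * l + 1) / offer_count h i l)"

text \<open>A new epoch starts at time 1 and after each no-purchase.  Ties may be broken by any rule,
  possibly randomized and depending on the whole history.\<close>

definition mnl_ucb_policy ::
    "nat \<Rightarrow> nat set set \<Rightarrow> (nat \<Rightarrow> real) \<Rightarrow> policy \<Rightarrow> bool" where
  "mnl_ucb_policy N F r \<pi> \<longleftrightarrow>
     (\<forall>h. if h = [] \<or> snd (last h) = 0
          then \<forall>S\<in>set_pmf (\<pi> h).
                 is_arg_max (revenue r (v_ucb N h (completed_epochs h))) (\<lambda>S'. S' \<in> F) S
          else \<pi> h = return_pmf (fst (last h)))"

lemma ex_mnl_ucb_policy:
  assumes "finite F" "F \<noteq> {}"
  shows "\<exists>\<pi>. mnl_ucb_policy N F r \<pi>"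
proof
  show "mnl_ucb_policy N F r
    (\<lambda>h. if h = [] \<or> snd (last h) = 0
         then return_pmf (best_assortment F r (v_ucb N h (completed_epochs h)))
         else return_pmf (fst (last h)))"
    using best_assortment_is_arg_max[OF assms] by (auto simp: mnl_ucb_policy_def)
qed

end

theory Submission
  imports Defs
begin

text \<open>Since an epoch ends at a step with probability \<open>1 / (1 + V(S))\<close>, the regret equals the
  expected sum, over completed epochs, of \<open>loss S = (1 + V(S)) (R* - R(S))\<close>.  If all confidence
  bounds hold, optimism gives \<open>loss S \<le> (\<Sum>j\<in>S. u j - v j)\<close>, and \<open>u j - v j\<close> is of order
  \<open>sqrt (\<Lambda> / n j)\<close> with \<open>\<Lambda> = ln (sqrt N * T + 1)\<close> once product \<open>j\<close> was offered in \<open>n j \<ge> \<Lambda>\<close>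
  epochs.  A suboptimal \<open>S\<close> has \<open>loss S \<ge> \<Delta>\<close>, so doubling the bound and subtracting \<open>\<Delta>\<close>
  charges each \<open>j \<in> S\<close> at most \<open>max 0 (c * sqrt (\<Lambda> / n j) - \<Delta> / N)\<close>; summed over \<open>n j\<close> this is
  of order \<open>\<Lambda> N / \<Delta>\<close> per product.  Epochs with some \<open>n j < \<Lambda>\<close> number about \<open>N \<Lambda>\<close> and cost at
  most \<open>N + 1\<close> each.  Confidence bounds fail with probability summable over epochs: the numbers of
  purchases are sums of geometric variables, controlled by an exponential martingale that follows the
  single time steps and is stopped after \<open>l\<close> epochs.  If \<open>N > T\<close>, the trivial bound \<open>T\<close> on the
  regret suffices.\<close>

section \<open>Confidence bounds for means of geometric variables\<close>

text \<open>Multiply by \<open>1 + x <= exp x\<close>: the product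
  \<open>(1 - x + x^2) * (1 + x)\<close> equals \<open>1 + x^3\<close>, which is at least 1.\<close>

lemma exp_neg_le_one_minus_lin_plus_square:
  fixes x :: real
  assumes "x \<ge> 0"
  shows "exp (-x) \<le> 1 - x + x\<^sup>2"
proof -
  have "1 \<le> (1 - x + x\<^sup>2) * (1 + x)"
    using assms by (simp add: algebra_simps power2_eq_square)
  also have "\<dots> \<le> (1 - x + x\<^sup>2) * exp x"
  proof (intro mult_left_mono exp_ge_add_one_self)
    have "1 - x + x\<^sup>2 = (1 - x / 2)\<^sup>2 + 3 / 4 * x\<^sup>2"
      by (simp add: power2_eq_square algebra_simps)
    then show "0 \<le> 1 - x + x\<^sup>2" by simp
  qed
  finally show ?thesis
    by (simp add: exp_minus field_simps)
qed

text \<open>In an epoch offering a product with parameter \<open>v\<close>, its number of purchases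
  is geometric with mean \<open>v\<close> and moment generating function
  \<open>1 / (1 - v * (exp x - 1))\<close>. The right-hand side is the reciprocal of that function.
  The restriction on \<open>x\<close> keeps \<open>y <= 1/2\<close>, where
  \<open>ln (1 - y) >= - y - 2 * y^2\<close> is available; the constant 5 covers
  \<open>1 + 2 * 16/9\<close>.\<close>

lemma geometric_mgf_inverse_ge_upper:
  fixes v x :: real
  assumes v: "0 \<le> v" "v \<le> 1" and x: "0 \<le> x" "x \<le> 1/3"
  shows "exp (- (v * x) - 5 * v * x\<^sup>2) \<le> 1 - v * (exp x - 1)"
proof -
  define y where "y = v * (exp x - 1)"
  have "exp x - 1 \<le> x + x\<^sup>2" using exp_bound[of x] x by simp
  then have y1: "y \<le> v * (x + x\<^sup>2)" unfolding y_def using v by (intro mult_left_mono)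
  have xx: "x\<^sup>2 \<le> x / 3" using x mult_left_mono[of x "1/3" x] by (simp add: power2_eq_square)
  have y0: "y \<ge> 0" unfolding y_def using v x by simp
  have "v * (x + x\<^sup>2) \<le> v * (4 / 3 * x)" using v xx by (intro mult_left_mono) auto
  then have y2: "y \<le> v * (4 / 3 * x)" using y1 by simp
  also have "\<dots> \<le> 1 * (4 / 3 * x)" using v x by (intro mult_right_mono) auto
  finally have y3: "y \<le> 1 / 2" using x by simp
  have "y\<^sup>2 \<le> (v * (4 / 3 * x))\<^sup>2" using y0 y2 by (rule power_mono[rotated])
  also have "\<dots> = (v * v) * (16 / 9 * x\<^sup>2)" by (simp add: power2_eq_square)
  also have "\<dots> \<le> v * (16 / 9 * x\<^sup>2)" using v by (intro mult_right_mono mult_left_le) auto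
  finally have "y\<^sup>2 \<le> v * (16 / 9 * x\<^sup>2)" .
  moreover have "v * x\<^sup>2 \<ge> 0" using v by simp
  ultimately have "- (v * x) - 5 * v * x\<^sup>2 \<le> - y - 2 * y\<^sup>2"
    using y1 by (simp add: algebra_simps)
  also have "\<dots> \<le> ln (1 - y)" using ln_one_minus_pos_lower_bound[OF y0 y3] by simp
  finally have "exp (- (v * x) - 5 * v * x\<^sup>2) \<le> exp (ln (1 - y))" by simp
  also have "\<dots> = 1 - y" using y3 by simp
  finally show ?thesis by (simp add: y_def)
qed

text \<open>The counterpart at \<open>-x\<close>. Here \<open>y <= 1\<close> holds for every
  \<open>x >= 0\<close>, so the lower tail needs no upper limit on \<open>x\<close>.\<close>

lemma geometric_mgf_inverse_ge_lower:
  fixes v x :: real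
  assumes v: "0 \<le> v" "v \<le> 1" and x: "0 \<le> x"
  shows "exp (v * x - 2 * v * x\<^sup>2) \<le> 1 - v * (exp (- x) - 1)"
proof -
  define y where "y = v * (1 - exp (- x))"
  have y0: "y \<ge> 0" unfolding y_def using v x by simp
  have "y \<le> 1 * 1" unfolding y_def using v x by (intro mult_mono) auto
  then have y3: "y \<le> 1" by simp
  have "1 - exp (- x) \<le> x" using exp_ge_add_one_self[of "-x"] by simp
  then have y2: "y \<le> v * x" unfolding y_def using v by (intro mult_left_mono) 
  have "x - x\<^sup>2 \<le> 1 - exp (- x)" using exp_neg_le_one_minus_lin_plus_square[OF x] by simp
  then have y1: "v * (x - x\<^sup>2) \<le> y" unfolding y_def using v by (intro mult_left_mono)
  have "y\<^sup>2 \<le> (v * x)\<^sup>2" using y0 y2 by (rule power_mono[rotated])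
  also have "\<dots> = (v * v) * x\<^sup>2" by (simp add: power2_eq_square)
  also have "\<dots> \<le> v * x\<^sup>2" using v by (intro mult_right_mono mult_left_le) auto
  finally have "v * x - 2 * v * x\<^sup>2 \<le> y - y\<^sup>2" using y1 by (simp add: algebra_simps)
  also have "\<dots> \<le> ln (1 + y)" using ln_one_plus_pos_lower_bound[OF y0 y3] .
  finally have "exp (v * x - 2 * v * x\<^sup>2) \<le> exp (ln (1 + y))" by simp
  also have "\<dots> = 1 + y" using y0 by simp
  finally show ?thesis by (simp add: y_def algebra_simps)
qed

text \<open>With \<open>C\<close> the number of purchases in \<open>n\<close> epochs, these are the deviations of the empirical
  mean \<open>C / n\<close> which would invalidate the confidence bound at level \<open>L\<close>.\<close>

definition over_dev :: "real \<Rightarrow> real \<Rightarrow> nat \<Rightarrow> nat \<Rightarrow> bool" where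
  "over_dev v L n C \<longleftrightarrow> L \<le> n \<and> real n * v + 15 * sqrt (n * L) < C"

definition under_dev :: "real \<Rightarrow> real \<Rightarrow> nat \<Rightarrow> nat \<Rightarrow> bool" where
  "under_dev v L n C \<longleftrightarrow> C < real n * v - 2 * sqrt (8 * n * v * L)"

text \<open>Chernoff's argument: on the deviation event, the exponential weight started at
  \<open>exp (-4 * L)\<close> has reached 1, so a supermartingale bound makes the event have
  probability at most \<open>exp (-4 * L)\<close>.\<close>

lemma over_dev_weight:
  fixes v L :: real
  assumes v: "0 < v" "v \<le> 1" and L: "L > 0" and n: "n > 0"
  obtains z where "z > 0" "1 - v * (z - 1) > 0"
    "\<And>C. over_dev v L n C \<Longrightarrow> 1 \<le> exp (-4 * L) * z ^ C * (1 - v * (z - 1)) ^ n"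
proof (cases "L \<le> n")
  case False
  then show ?thesis by (intro that[of 1]) (auto simp: over_dev_def)
next
  case True
  \<comment> \<open>Since \<open>L <= n\<close>, this gives \<open>x <= 1/3\<close>. The deviation
    \<open>15 * sqrt (n * L)\<close> contributes \<open>5 * L\<close> to the exponent and the
    quadratic term costs at most \<open>L\<close>, which leaves \<open>4 * L\<close>.\<close>
  define x where "x = sqrt (L / n) / 3"
  have x: "0 \<le> x" "x \<le> 1 / 3" using L n True by (auto simp: x_def field_simps)
  have x2: "n * x\<^sup>2 = L / 9" using L n by (simp add: x_def power_divide)
  have xs: "x * sqrt (n * L) = L / 3"
    using L n by (simp add: x_def real_sqrt_divide real_sqrt_mult)
  let ?q = "1 - v * (exp x - 1)"
  have q: "exp (- (v * x) - 5 * v * x\<^sup>2) \<le> ?q"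
    using geometric_mgf_inverse_ge_upper[of v x] v x by simp
  show ?thesis
  proof (rule that[of "exp x"])
    show "?q > 0" using q exp_gt_zero less_le_trans by blast
    fix C assume C: "over_dev v L n C"
    then have "x * (n * v + 15 * sqrt (n * L)) \<le> x * C"
      using x by (intro mult_left_mono) (auto simp: over_dev_def)
    then have a: "n * v * x + 5 * L \<le> x * C" using xs by (simp add: algebra_simps)
    have "v * (n * x\<^sup>2) \<le> 1 * (n * x\<^sup>2)" using v by (intro mult_right_mono) auto
    then have b: "5 * v * (n * x\<^sup>2) \<le> L" using x2 L unfolding mult.assoc by linarith
    have "0 \<le> -4 * L + real C * x + real n * (- (v * x) - 5 * v * x\<^sup>2)"
      using a b by (simp add: algebra_simps)
    then have "1 \<le> exp (-4 * L + real C * x + real n * (- (v * x) - 5 * v * x\<^sup>2))" by simp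
    also have "\<dots> = exp (-4 * L) * exp x ^ C * exp (- (v * x) - 5 * v * x\<^sup>2) ^ n"
      by (simp only: exp_add exp_of_nat_mult)
    also have "\<dots> \<le> exp (-4 * L) * exp x ^ C * ?q ^ n"
      using q by (intro mult_left_mono power_mono) auto
    finally show "1 \<le> exp (-4 * L) * exp x ^ C * ?q ^ n" .
  qed simp
qed

lemma under_dev_weight:
  fixes v L :: real
  assumes v: "0 < v" "v \<le> 1" and L: "L > 0" and n: "n > 0"
  obtains z where "z > 0" "1 - v * (z - 1) > 0"
    "\<And>C. under_dev v L n C \<Longrightarrow> 1 \<le> exp (-4 * L) * z ^ C * (1 - v * (z - 1)) ^ n"
proof -
  \<comment> \<open>This maximises \<open>x * 2 * sqrt (8 * n * v * L) - 2 * n * v * x^2\<close>;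
    the maximum is \<open>8 * L - 4 * L = 4 * L\<close>.\<close>
  define x where "x = sqrt (2 * L / (n * v))"
  have x: "0 \<le> x" using L n v by (auto simp: x_def)
  have x2: "n * v * x\<^sup>2 = 2 * L" using L n v by (simp add: x_def)
  have xs: "x * sqrt (8 * n * v * L) = 4 * L"
  proof -
    have "x * sqrt (8 * n * v * L) = sqrt ((4 * L)\<^sup>2)"
      unfolding x_def real_sqrt_mult[symmetric] using L n v by (simp add: power2_eq_square)
    also have "\<dots> = 4 * L" using L by (subst real_sqrt_abs) simp
    finally show ?thesis .
  qed
  let ?q = "1 - v * (exp (-x) - 1)"
  have q: "exp (v * x - 2 * v * x\<^sup>2) \<le> ?q"
    using geometric_mgf_inverse_ge_lower[of v x] v x by simp
  show ?thesis
  proof (rule that[of "exp (-x)"])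
    show "?q > 0" using q exp_gt_zero less_le_trans by blast
    fix C assume C: "under_dev v L n C"
    then have "x * C \<le> x * (n * v - 2 * sqrt (8 * n * v * L))"
      using x by (intro mult_left_mono) (auto simp: under_dev_def)
    then have a: "x * C \<le> n * v * x - 8 * L" using xs by (simp add: algebra_simps)
    have "0 \<le> -4 * L + real C * (-x) + real n * (v * x - 2 * v * x\<^sup>2)"
      using a x2 by (simp add: algebra_simps)
    then have "1 \<le> exp (-4 * L + real C * (-x) + real n * (v * x - 2 * v * x\<^sup>2))" by simp
    also have "\<dots> = exp (-4 * L) * exp (-x) ^ C * exp (v * x - 2 * v * x\<^sup>2) ^ n"
      by (simp only: exp_add exp_of_nat_mult)
    also have "\<dots> \<le> exp (-4 * L) * exp (-x) ^ C * ?q ^ n"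
      using q by (intro mult_left_mono power_mono) auto
    finally show "1 \<le> exp (-4 * L) * exp (-x) ^ C * ?q ^ n" .
  qed simp
qed

text \<open>The index of the algorithm as a function of the level, the number of epochs offering the
  product and its number of purchases. The default 1 is an upper bound for every
  \<open>v i\<close>.\<close>

definition ucb :: "real \<Rightarrow> nat \<Rightarrow> nat \<Rightarrow> real" where
  "ucb L n C = (if n = 0 then 1 else C / n + sqrt (C / n * (48 * L / n)) + 48 * L / n)"

text \<open>With \<open>d = 8 * L / n\<close>, the absence of a deviation reads
  \<open>v - 2 * sqrt (v * d) <= a\<close>. Completing the square and solving for \<open>v\<close>
  gives \<open>v <= a + sqrt (a * (4 * d)) + 4 * d\<close>, and \<open>4 * d = 32 * L / n\<close> is
  below the \<open>48 * L / n\<close> of the index.\<close>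

lemma ucb_ge:
  assumes v: "0 < v" "v \<le> 1" and L: "L > 0" and "n = 0 \<or> \<not> under_dev v L n C"
  shows "v \<le> ucb L n C"
proof (cases "n = 0")
  case True
  then show ?thesis using v by (simp add: ucb_def)
next
  case False
  define a where "a = C / n"
  define d where "d = 8 * L / n"
  have n: "n > 0" using False by simp
  have a0: "a \<ge> 0" and d0: "d \<ge> 0" using L by (auto simp: a_def d_def)
  have "real n * v - 2 * sqrt (8 * n * v * L) \<le> C"
    using assms(4) False by (simp add: under_dev_def)
  moreover have "sqrt (8 * n * v * L) = n * sqrt (v * d)"
  proof -
    have "sqrt (8 * n * v * L) = sqrt ((real n)\<^sup>2 * (v * d))"
      using n by (simp add: d_def power2_eq_square algebra_simps)
    then show ?thesis by (simp only: real_sqrt_mult real_sqrt_abs abs_of_nat)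
  qed
  ultimately have "v - 2 * sqrt (v * d) \<le> a"
    using n by (simp add: a_def field_simps)
  then have "(sqrt v - sqrt d)\<^sup>2 \<le> a + d"
    using v d0 by (simp add: power2_diff real_sqrt_mult)
  then have "sqrt v - sqrt d \<le> sqrt (a + d)"
    using real_le_rsqrt by blast
  then have "v \<le> (sqrt (a + d) + sqrt d)\<^sup>2"
    using v d0 a0 by (intro sqrt_le_D) auto
  also have "\<dots> = a + 2 * d + 2 * sqrt (d * (a + d))"
    using a0 d0 by (simp add: power2_sum real_sqrt_mult)
  also have "sqrt (d * (a + d)) \<le> sqrt (a * d) + d"
  proof -
    have "sqrt (a * d + d\<^sup>2) \<le> sqrt (a * d) + sqrt (d\<^sup>2)"
      using a0 d0 by (intro sqrt_add_le_add_sqrt) auto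
    then show ?thesis using d0 by (simp add: power2_eq_square algebra_simps)
  qed
  also have "a + 2 * d + 2 * (sqrt (a * d) + d) = a + sqrt (a * (4 * d)) + 4 * d"
    using real_sqrt_mult[of 4 "a * d"] by (simp add: mult.left_commute)
  also have "\<dots> \<le> a + sqrt (a * (48 * L / n)) + 48 * L / n"
    using a0 d0 L n by (intro add_mono real_sqrt_le_mono mult_left_mono) (auto simp: d_def field_simps)
  finally show ?thesis using False by (simp add: ucb_def a_def)
qed

text \<open>With \<open>x = sqrt (L / n) <= 1\<close> the mean is at most
  \<open>v + 15 * x <= 16\<close>. The square root term is then at most \<open>28 * x\<close>
  because \<open>48 * 16 <= 28^2\<close>, the last term is at most \<open>48 * x\<close>, and
  \<open>15 + 28 + 48 <= 100\<close>.\<close>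

lemma ucb_le:
  assumes v: "0 < v" "v \<le> 1" and L: "L > 0" and n: "L \<le> n" and C: "\<not> over_dev v L n C"
  shows "ucb L n C \<le> v + 100 * sqrt (L / n)"
proof -
  define a where "a = C / n"
  define x where "x = sqrt (L / n)"
  have n0: "n > 0" using L n by (cases n) auto
  have x0: "x \<ge> 0" "x \<le> 1" using L n n0 by (auto simp: x_def)
  have xx: "L / n = x\<^sup>2" using L by (simp add: x_def)
  then have xle: "L / n \<le> x" using x0 by (simp add: power2_eq_square mult_left_le)
  have "C \<le> n * v + 15 * sqrt (n * L)" using C n by (simp add: over_dev_def)
  moreover have "sqrt (n * L) = n * x"
  proof -
    have "sqrt (n * L) = sqrt ((real n)\<^sup>2 * (L / n))"
      using n0 by (simp add: power2_eq_square)
    then show ?thesis unfolding x_def by (simp only: real_sqrt_mult real_sqrt_abs abs_of_nat)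
  qed
  ultimately have a1: "a \<le> v + 15 * x" using n0 by (simp add: a_def field_simps)
  then have a2: "a \<le> 16" using v x0 by simp
  have "sqrt (a * (48 * L / n)) = sqrt (a * 48 * x\<^sup>2)" by (simp flip: xx)
  also have "\<dots> \<le> sqrt ((28 * x)\<^sup>2)"
    using a2 by (intro real_sqrt_le_mono) (simp add: power_mult_distrib mult_right_mono)
  also have "\<dots> = 28 * x" using x0 by (subst real_sqrt_abs) simp
  finally have "sqrt (a * (48 * L / n)) \<le> 28 * x" .
  moreover have "48 * L / n \<le> 48 * x" using xle by simp
  moreover have "ucb L n C = a + sqrt (a * (48 * L / n)) + 48 * L / n"
    using n0 by (simp add: ucb_def a_def)
  ultimately show ?thesis using a1 x0 unfolding x_def[symmetric] by simp
qed

section \<open>Elementary sums and logarithms\<close>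

lemma sum_inverse_sqrt_le: "(\<Sum>n=1..M. 1 / sqrt (real n)) \<le> 2 * sqrt M"
proof (induction M)
  case (Suc M)
  have "1 \<le> 2 * (sqrt (Suc M) - sqrt M) * sqrt (Suc M)"
  proof -
    have "0 \<le> (sqrt (Suc M) - sqrt M)\<^sup>2" by simp
    then have "2 * (sqrt (Suc M) * sqrt M) \<le> Suc M + M"
      by (simp add: power2_diff)
    then show ?thesis by (simp add: algebra_simps)
  qed
  then have "1 / sqrt (Suc M) \<le> 2 * (sqrt (Suc M) - sqrt M)"
    by (simp add: divide_le_eq)
  then show ?case using Suc by simp
qed simp

text \<open>The terms vanish beyond \<open>n = (a / d)^2\<close>. Up to there \<open>d\<close> is
  ignored, and the sum of \<open>1 / sqrt n\<close> contributes twice the root of the cutoff. This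
  produces the dependence on the inverse gap.\<close>

lemma sum_pos_part_inverse_sqrt_le:
  fixes a d :: real
  assumes a: "a \<ge> 0" and d: "d > 0"
  shows "(\<Sum>n=1..<M. max 0 (a / sqrt (real n) - d)) \<le> 2 * a\<^sup>2 / d"
proof -
  define K where "K = nat \<lfloor>(a / d)\<^sup>2\<rfloor>"
  have le: "max 0 (a / sqrt (real n) - d) \<le> (if n \<le> K then a * (1 / sqrt n) else 0)"
    if n: "n \<ge> 1" for n
  proof (cases "n \<le> K")
    case False
    then have "(a / d)\<^sup>2 < n" unfolding K_def by linarith
    then have "a / d < sqrt n" using real_less_rsqrt by blast
    then have "a / sqrt n < d" using d n by (simp add: field_simps)
    then show ?thesis using False by simp
  qed (use a d in auto)
  have "(\<Sum>n=1..<M. max 0 (a / sqrt (real n) - d)) \<le> (\<Sum>n=1..<M. if n \<in> {n. n \<le> K} then a * (1 / sqrt n) else 0)"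
    using le by (intro sum_mono) auto
  also have "\<dots> = (\<Sum>n\<in>{1..<M} \<inter> {n. n \<le> K}. a * (1 / sqrt n))"
    by (subst sum.inter_restrict) auto
  also have "\<dots> \<le> (\<Sum>n=1..K. a * (1 / sqrt n))"
    using a by (intro sum_mono2) auto
  also have "\<dots> \<le> a * (2 * sqrt K)"
    unfolding sum_distrib_left[symmetric] using a by (intro mult_left_mono sum_inverse_sqrt_le)
  also have "\<dots> \<le> a * (2 * (a / d))"
  proof -
    have "real K \<le> (a / d)\<^sup>2" unfolding K_def by simp
    then have "sqrt K \<le> a / d" using a d by (intro real_le_lsqrt) auto
    then show ?thesis using a by (intro mult_left_mono) auto
  qed
  finally show ?thesis by (simp add: power2_eq_square mult.left_commute mult.commute)
qed

text \<open>Telescoping: \<open>1 / (n + 1)^2 <= 1 / n - 1 / (n + 1)\<close>.\<close>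

lemma sum_inverse_squares_le: "(\<Sum>l=1..n. 1 / (real l)\<^sup>2) \<le> 2"
proof -
  have "(\<Sum>l=1..n. 1 / (real l)\<^sup>2) \<le> 2 - 1 / n" if "n \<ge> 1"
    using that
  proof (induction n rule: dec_induct)
    case (step n)
    have "1 / (real (Suc n))\<^sup>2 \<le> 1 / (n * Suc n)"
      using step.hyps by (intro divide_left_mono) (auto simp: power2_eq_square algebra_simps intro: add_pos_nonneg)
    also have "\<dots> = 1 / n - 1 / Suc n"
      using step.hyps by (simp add: field_simps)
    finally show ?case using step.IH by simp
  qed simp
  then show ?thesis by (cases "n = 0") (auto intro: order_trans)
qed

lemma ln_2_ge_half: "1 / 2 \<le> ln (2::real)"
proof -
  have "exp (1 / 2 :: real) \<le> 2" using exp_bound_half[of "1/2::real"] by simp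
  then show ?thesis by (subst ln_ge_iff) auto
qed

text \<open>The logarithm from the confidence radius; its factor 48 is part of
  \<open>ucb\<close>.\<close>

definition log_level :: "nat \<Rightarrow> nat \<Rightarrow> real" where
  "log_level N l = ln (sqrt N * l + 1)"

lemma log_level_pos: "N \<ge> 1 \<Longrightarrow> l \<ge> 1 \<Longrightarrow> log_level N l > 0"
  unfolding log_level_def by (intro ln_gt_zero) simp

lemma log_level_mono: "l \<le> l' \<Longrightarrow> log_level N l \<le> log_level N l'"
  unfolding log_level_def by (subst ln_le_cancel_iff) (auto intro!: add_nonneg_pos mult_left_mono)

text \<open>The exponent 4 is large enough for a union bound over \<open>N\<close> products and
  \<open>l\<close> possible counts, with a remainder summable over \<open>l\<close>.\<close>

lemma exp_log_level_le:
  assumes "N \<ge> 1" "l \<ge> 1"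
  shows "exp (-4 * log_level N l) \<le> 1 / ((real N)\<^sup>2 * real l ^ 4)"
proof -
  have p: "sqrt N * l + 1 > 0" by (simp add: add_nonneg_pos)
  have "exp (-4 * log_level N l) = 1 / exp (log_level N l) ^ 4"
    using exp_of_nat_mult[of 4 "log_level N l"] by (simp add: exp_minus field_simps)
  also have "\<dots> = 1 / (sqrt N * l + 1) ^ 4" using p by (simp add: log_level_def)
  also have "\<dots> \<le> 1 / (sqrt N * l) ^ 4"
    using assms p by (intro divide_left_mono power_mono) auto
  also have "(sqrt N * l) ^ 4 = (real N)\<^sup>2 * real l ^ 4"
  proof -
    have "sqrt N ^ 4 = (sqrt N ^ 2) ^ 2" by (simp only: power_mult[symmetric]) simp
    then show ?thesis by (simp add: power_mult_distrib)
  qed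
  finally show ?thesis .
qed

text \<open>For \<open>N <= T\<close> the argument of the logarithm is at most \<open>T^3\<close>;
  the additional 1 is at most \<open>2 * ln T\<close>, as \<open>ln 2 >= 1/2\<close>.\<close>

lemma log_level_le_ln:
  assumes "N \<le> T" "T \<ge> 2"
  shows "log_level N T + 1 \<le> 5 * ln T"
proof -
  have T: "real T \<ge> 2" using assms by simp
  have "N \<le> T * T" using assms by (metis le_square order_trans)
  then have "sqrt N \<le> T"
    by (intro real_le_lsqrt) (auto simp: power2_eq_square simp flip: of_nat_mult)
  then have "sqrt N * T \<le> real T * T" by (intro mult_right_mono) auto
  also have "\<dots> + 1 \<le> T * T * T"
  proof -
    have "1 \<le> real T * real T * (real T - 1)" 
      using T mult_mono[of 2 "real T" 2 "real T"] mult_mono[of 4 "real T * real T" 1 "real T - 1"] by simp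
    then show ?thesis by (simp add: algebra_simps)
  qed
  finally have "sqrt N * T + 1 \<le> real T ^ 3" by (simp add: power3_eq_cube)
  then have "log_level N T \<le> ln (real T ^ 3)"
    unfolding log_level_def using T by (subst ln_le_cancel_iff) (auto intro!: add_nonneg_pos)
  also have "\<dots> = 3 * ln T" using T by (simp add: ln_realpow)
  finally have "log_level N T \<le> 3 * ln T" .
  moreover note ln_2_ge_half
  moreover have "ln 2 \<le> ln (real T)" using T by simp
  ultimately show ?thesis by simp
qed

section \<open>Epochs in a history\<close>

lemma card_positions:
  "card {t\<in>{1..length xs}. P (xs ! (t - 1))} = length (filter P xs)"
proof -
  have "card {t\<in>{1..length xs}. P (xs ! (t - 1))} = card (Suc ` {i. i < length xs \<and> P (xs ! i)})"
    by (intro arg_cong[where f = card] equalityI subsetI)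
      (auto intro!: image_eqI[where f = Suc, OF Suc_pred[symmetric]])
  then show ?thesis by (simp add: card_image length_filter_conv_card)
qed

text \<open>An additive functional of the path: each step is charged according to the history
  strictly before it and the new entry, in accordance with the recursion of
  \<open>trajectory\<close>.\<close>

definition path_sum :: "(history \<Rightarrow> nat set \<times> nat \<Rightarrow> real) \<Rightarrow> history \<Rightarrow> real" where
  "path_sum f h = (\<Sum>t<length h. f (take t h) (h ! t))"

lemma path_sum_Nil [simp]: "path_sum f [] = 0"
  by (simp add: path_sum_def)

lemma path_sum_snoc [simp]: "path_sum f (h @ [x]) = path_sum f h + f h x"
  by (simp add: path_sum_def nth_append)

lemma path_sum_sum: "path_sum (\<lambda>h x. \<Sum>k\<in>J. f k h x) h = (\<Sum>k\<in>J. path_sum (f k) h)"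
  unfolding path_sum_def by (rule sum.swap)

definition epoch_start :: "history \<Rightarrow> bool" where
  "epoch_start h \<longleftrightarrow> h = [] \<or> snd (last h) = 0"

text \<open>The history up to the beginning of the epoch in progress.\<close>

definition current_start :: "history \<Rightarrow> history" where
  "current_start h = rev (dropWhile (\<lambda>x. snd x \<noteq> 0) (rev h))"

lemma current_start_snoc:
  "current_start (h @ [x]) = (if snd x = 0 then h @ [x] else current_start h)"
  by (simp add: current_start_def)

text \<open>A completed epoch is represented by its closing no-purchase step, so this counter
  evolves entry by entry.\<close>

definition epochs_with :: "nat \<Rightarrow> history \<Rightarrow> nat" where
  "epochs_with i h = length (filter (\<lambda>x. i \<in> fst x \<and> snd x = 0) h)"

definition purchases :: "nat \<Rightarrow> history \<Rightarrow> nat" where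
  "purchases i h = length (filter (\<lambda>x. snd x = i) h)"

lemma completed_epochs_eq: "completed_epochs h = length (filter (\<lambda>x. snd x = 0) h)"
  unfolding completed_epochs_def chosen_def by (rule card_positions)

lemma epochs_with_le: "epochs_with i h \<le> completed_epochs h"
  unfolding epochs_with_def completed_epochs_eq by (induction h) auto

lemma completed_epochs_le: "completed_epochs h \<le> length h"
  by (simp add: completed_epochs_eq)

lemma counts_simps [simp]:
  "completed_epochs [] = 0" "epochs_with i [] = 0" "purchases i [] = 0"
  "completed_epochs (h @ [x]) = completed_epochs h + of_bool (snd x = 0)"
  "epochs_with i (h @ [x]) = epochs_with i h + of_bool (i \<in> fst x \<and> snd x = 0)"
  "purchases i (h @ [x]) = purchases i h + of_bool (snd x = i)"
  by (auto simp: completed_epochs_eq epochs_with_def purchases_def)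

text \<open>Along such a history, the assortment at the closing step of an epoch is the assortment
  of the whole epoch.\<close>

definition coherent :: "history \<Rightarrow> bool" where
  "coherent h \<longleftrightarrow>
    (\<forall>t. Suc t < length h \<longrightarrow> snd (h ! t) \<noteq> 0 \<longrightarrow> fst (h ! Suc t) = fst (h ! t))"

lemma coherent_snoc:
  assumes "coherent h" "\<not> epoch_start h \<Longrightarrow> fst x = fst (last h)"
  shows "coherent (h @ [x])"
  unfolding coherent_def
proof (intro allI impI)
  fix t assume t: "Suc t < length (h @ [x])" "snd ((h @ [x]) ! t) \<noteq> 0"
  show "fst ((h @ [x]) ! Suc t) = fst ((h @ [x]) ! t)"
  proof (cases "Suc t < length h")
    case True
    then show ?thesis using assms(1) t(2) by (simp add: coherent_def nth_append)
  next
    case False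
    then have l: "length h = Suc t" using t by simp
    then have "last h = h ! t" by (metis diff_Suc_1 last_conv_nth length_0_conv nat.distinct(1))
    moreover from this have "\<not> epoch_start h" using l t(2) by (auto simp: nth_append epoch_start_def)
    ultimately show ?thesis using l assms(2) by (simp add: nth_append)
  qed
qed

text \<open>The map \<open>e\<close> sends a time to the number of its epoch and is a bijection from
  the no-purchase times onto the completed epochs, so epochs can be counted by their closing steps.
  For purchases, the epochs partition the time steps, and product \<open>i\<close> is bought only in
  epochs that offer it.\<close>

lemma
  assumes coh: "coherent h" and start: "epoch_start h"
  shows offer_count_eq: "offer_count h i (completed_epochs h) = epochs_with i h"
    and sum_v_hat_eq: "(\<And>x. x \<in> set h \<Longrightarrow> snd x = i \<Longrightarrow> i \<in> fst x) \<Longrightarrow>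
      (\<Sum>\<tau>\<in>offer_epochs h i (completed_epochs h). v_hat h i \<tau>) = purchases i h"
proof -
  define e where "e t = card {s\<in>{1..<t}. chosen h s = 0} + 1" for t
  define Z where "Z = {t\<in>{1..length h}. chosen h t = 0}"
  define L where "L = completed_epochs h"
  have L: "L = card Z" by (simp add: L_def completed_epochs_def Z_def)
  have times: "epoch_times h l = {t\<in>{1..length h}. e t = l}" for l
    by (simp add: epoch_times_def e_def)
  have mono: "e t \<le> e t'" if "t \<le> t'" for t t'
    unfolding e_def using that by (intro add_right_mono card_mono) auto
  have strict: "e t < e t'" if "1 \<le> t" "t < t'" "chosen h t = 0" for t t'
    unfolding e_def using that by (intro add_strict_right_mono psubset_card_mono) auto
  \<comment> \<open>A no-purchase between the two times would increase \<open>e\<close>, so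
    coherence carries the assortment forward.\<close>
  have const: "offered h t' = offered h t" if "t \<le> t'" "1 \<le> t" "t' \<le> length h" "e t = e t'" for t t'
    using that
  proof (induction t' rule: dec_induct)
    case (step k)
    have "e t = e k" using mono[of t k] mono[of k "Suc k"] step by simp
    moreover have "chosen h k \<noteq> 0" using strict[of k "Suc k"] step calculation by auto
    then have "offered h (Suc k) = offered h k"
      using coh[unfolded coherent_def, rule_format, of "k - 1"] step
      by (simp add: chosen_def offered_def)
    ultimately show ?case using step by simp
  qed simp
  have assort: "epoch_assortment h (e t) = offered h t" if t: "t \<in> {1..length h}" for t
  proof -
    have fin: "finite (epoch_times h (e t))" and mem: "t \<in> epoch_times h (e t)"
      using t by (auto simp: times)
    have "Min (epoch_times h (e t)) \<in> epoch_times h (e t)" "Min (epoch_times h (e t)) \<le> t"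
      using Min_in[OF fin] Min_le[OF fin mem] mem by auto
    then show ?thesis using const[of "Min (epoch_times h (e t))" t] t
      unfolding epoch_assortment_def by (auto simp: times)
  qed
  \<comment> \<open>No epoch is left unfinished: the last entry is a no-purchase that is not counted
    before \<open>t\<close>, so strictly fewer than \<open>L\<close> are.\<close>
  have e_le: "e t \<in> {1..L}" if t: "t \<in> {1..length h}" for t
  proof -
    have "h \<noteq> []" using t by auto
    then have "chosen h (length h) = 0"
      using start by (simp add: epoch_start_def chosen_def last_conv_nth)
    then have "length h \<in> Z" using t by (simp add: Z_def)
    moreover have "{s\<in>{1..<t}. chosen h s = 0} \<subseteq> Z" using t by (auto simp: Z_def)
    moreover have "length h \<notin> {s\<in>{1..<t}. chosen h s = 0}" using t by simp
    ultimately have "{s\<in>{1..<t}. chosen h s = 0} \<subset> Z" by blast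
    moreover have "finite Z" by (simp add: Z_def)
    ultimately have "card {s\<in>{1..<t}. chosen h s = 0} < card Z"
      by (rule psubset_card_mono[rotated])
    then show ?thesis by (simp add: e_def L)
  qed
  have inj: "inj_on e Z"
  proof (rule inj_onI)
    fix t t' assume "t \<in> Z" "t' \<in> Z" "e t = e t'"
    then show "t = t'" using strict[of t t'] strict[of t' t] by (cases t t' rule: linorder_cases) (auto simp: Z_def)
  qed
  have img: "e ` Z = {1..L}"
  proof (rule card_subset_eq)
    show "e ` Z \<subseteq> {1..L}" using e_le by (auto simp: Z_def)
    show "card (e ` Z) = card {1..L}" using card_image[OF inj] by (simp add: L)
  qed simp
  have "offer_epochs h i L = e ` {t\<in>Z. i \<in> offered h t}"
  proof -
    have "offer_epochs h i L = {\<tau>\<in>e ` Z. i \<in> epoch_assortment h \<tau>}"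
      by (simp add: offer_epochs_def img)
    also have "\<dots> = e ` {t\<in>Z. i \<in> offered h t}"
      using assort by (auto simp: Z_def)
    finally show ?thesis .
  qed
  then have "offer_count h i L = card {t\<in>Z. i \<in> offered h t}"
    unfolding offer_count_def using inj by (simp add: card_image inj_on_def)
  also have "{t\<in>Z. i \<in> offered h t} =
    {t\<in>{1..length h}. (\<lambda>x. i \<in> fst x \<and> snd x = 0) (h ! (t - 1))}"
    by (auto simp: Z_def offered_def chosen_def)
  also have "card \<dots> = epochs_with i h"
    unfolding epochs_with_def by (rule card_positions)
  finally show "offer_count h i (completed_epochs h) = epochs_with i h" by (simp add: L_def)
  assume valid: "\<And>x. x \<in> set h \<Longrightarrow> snd x = i \<Longrightarrow> i \<in> fst x"
  have "(\<Sum>\<tau>\<in>offer_epochs h i L. v_hat h i \<tau>) =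
    (\<Sum>t\<in>(\<Union>\<tau>\<in>offer_epochs h i L. epoch_times h \<tau>). of_bool (chosen h t = i))"
    unfolding v_hat_def by (rule sum.UNION_disjoint[symmetric]) (auto simp: times offer_epochs_def)
  also have "\<dots> = (\<Sum>t\<in>{1..length h}. of_bool (chosen h t = i))"
  proof (rule sum.mono_neutral_left)
    show "\<forall>t\<in>{1..length h} - (\<Union>\<tau>\<in>offer_epochs h i L. epoch_times h \<tau>). of_bool (chosen h t = i) = (0 :: real)"
    proof
      fix t assume t: "t \<in> {1..length h} - (\<Union>\<tau>\<in>offer_epochs h i L. epoch_times h \<tau>)"
      have "h ! (t - 1) \<in> set h" using t by (intro nth_mem) auto
      then have "chosen h t \<noteq> i \<or> i \<in> offered h t"
        using valid unfolding chosen_def offered_def by blast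
      then show "of_bool (chosen h t = i) = (0 :: real)"
        using t assort[of t] e_le[of t] by (auto simp: offer_epochs_def times)
    qed
  qed (auto simp: times)
  also have "\<dots> = card {t\<in>{1..length h}. (\<lambda>x. snd x = i) (h ! (t - 1))}"
    by (simp add: chosen_def Int_def)
  also have "card {t\<in>{1..length h}. (\<lambda>x. snd x = i) (h ! (t - 1))} = purchases i h"
    unfolding purchases_def by (rule card_positions)
  finally show "(\<Sum>\<tau>\<in>offer_epochs h i (completed_epochs h). v_hat h i \<tau>) = purchases i h"
    by (simp add: L_def)
qed

section \<open>Random trajectories\<close>

lemma expectation_mono_finite:
  fixes f g :: "'a \<Rightarrow> real"
  assumes "finite (set_pmf p)" "\<And>x. x \<in> set_pmf p \<Longrightarrow> f x \<le> g x"
  shows "measure_pmf.expectation p f \<le> measure_pmf.expectation p g"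
  using assms by (intro integral_mono_AE integrable_measure_pmf_finite) (auto simp: AE_measure_pmf_iff)

lemma expectation_cong_pmf:
  fixes f g :: "'a \<Rightarrow> real"
  assumes "\<And>x. x \<in> set_pmf p \<Longrightarrow> f x = g x"
  shows "measure_pmf.expectation p f = measure_pmf.expectation p g"
  using assms by (intro integral_cong_AE) (auto simp: AE_measure_pmf_iff)

lemma expectation_bind_finite:
  fixes f :: "'b \<Rightarrow> real"
  assumes "finite (set_pmf p)" "\<And>x. x \<in> set_pmf p \<Longrightarrow> finite (set_pmf (g x))"
  shows "measure_pmf.expectation (bind_pmf p g) f =
    measure_pmf.expectation p (\<lambda>x. measure_pmf.expectation (g x) f)"
  using pmf_expectation_bind[of "set_pmf p" g p f] assms
    integral_measure_pmf[of "set_pmf p" p "\<lambda>x. measure_pmf.expectation (g x) f"]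
  by simp

locale mnl_ucb =
  fixes N :: nat and F :: "nat set set" and r v :: "nat \<Rightarrow> real" and \<pi> :: policy
  assumes N: "N \<ge> 1"
    and F_sub: "S \<in> F \<Longrightarrow> S \<subseteq> {1..N}"
    and F_down: "S \<in> F \<Longrightarrow> Q \<subseteq> S \<Longrightarrow> Q \<in> F"
    and r: "i \<in> {1..N} \<Longrightarrow> 0 \<le> r i \<and> r i \<le> 1"
    and v0: "v 0 = 1"
    and v: "i \<in> {1..N} \<Longrightarrow> 0 < v i \<and> v i \<le> 1"
    and policy: "mnl_ucb_policy N F r \<pi>"
begin

abbreviation "reachable t \<equiv> set_pmf (trajectory v \<pi> t)"
abbreviation "expect t \<equiv> measure_pmf.expectation (trajectory v \<pi> t)"

definition weight :: "nat set \<Rightarrow> real" where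
  "weight S = 1 + (\<Sum>j\<in>S. v j)"

definition Rstar :: real where
  "Rstar = revenue r v (best_assortment F r v)"

definition loss :: "nat set \<Rightarrow> real" where
  "loss S = weight S * (Rstar - revenue r v S)"

lemma finite_F: "finite F"
  using F_sub by (intro finite_subset[of F "Pow {1..N}"]) auto

text \<open>The initial law of the policy has nonempty support, and its members maximise over
  \<open>F\<close>.\<close>

lemma F_nonempty: "F \<noteq> {}"
proof -
  obtain S where "S \<in> set_pmf (\<pi> [])" using set_pmf_not_empty by fast
  then show ?thesis using policy unfolding mnl_ucb_policy_def by (auto dest!: spec[of _ "[]"] simp: is_arg_max_def)
qed

lemma finite_assortment: "S \<in> F \<Longrightarrow> finite S"
  using F_sub finite_subset by blast

lemma zero_notin: "S \<in> F \<Longrightarrow> 0 \<notin> S"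
  using F_sub by force

lemma v_pos: "S \<in> F \<Longrightarrow> i \<in> S \<Longrightarrow> 0 < v i \<and> v i \<le> 1"
  using F_sub v by blast

lemma weight_ge: "S \<in> F \<Longrightarrow> weight S \<ge> 1"
  unfolding weight_def using v_pos by (simp add: sum_nonneg less_imp_le)

lemma weight_le: "S \<in> F \<Longrightarrow> weight S \<le> N + 1"
proof -
  assume S: "S \<in> F"
  have "(\<Sum>j\<in>S. v j) \<le> (\<Sum>j\<in>S. 1)" using S v_pos by (intro sum_mono) auto
  also have "\<dots> \<le> N" using card_mono[OF _ F_sub[OF S]] by simp
  finally show ?thesis by (simp add: weight_def)
qed

lemma pmf_choice:
  "S \<in> F \<Longrightarrow> pmf (mnl_choice v S) i = (if i \<in> insert 0 S then v i / weight S else 0)"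
  using pmf_mnl_choice[of S v i] finite_assortment zero_notin v_pos
  by (simp add: weight_def v0 less_imp_le)

lemma set_choice: "S \<in> F \<Longrightarrow> set_pmf (mnl_choice v S) \<subseteq> insert 0 S"
  by (auto simp: set_pmf_iff pmf_choice split: if_splits)

lemma finite_choice: "S \<in> F \<Longrightarrow> finite (set_pmf (mnl_choice v S))"
  using set_choice finite_assortment finite_subset by blast

lemma expectation_choice:
  fixes f :: "nat \<Rightarrow> real"
  assumes S: "S \<in> F"
  shows "measure_pmf.expectation (mnl_choice v S) f = (f 0 + (\<Sum>i\<in>S. v i * f i)) / weight S"
proof -
  have "measure_pmf.expectation (mnl_choice v S) f = (\<Sum>i\<in>insert 0 S. f i * pmf (mnl_choice v S) i)"
    using set_choice[OF S] finite_assortment[OF S] by (intro integral_measure_pmf_real) auto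
  also have "\<dots> = f 0 / weight S + (\<Sum>i\<in>S. f i * (v i / weight S))"
    using finite_assortment[OF S] zero_notin[OF S] S by (simp add: pmf_choice v0)
  finally show ?thesis
    by (simp add: add_divide_distrib sum_divide_distrib mult.commute)
qed

lemma reachable_Suc:
  "h \<in> reachable (Suc t) \<longleftrightarrow>
    (\<exists>h' S c. h = h' @ [(S, c)] \<and> h' \<in> reachable t \<and> S \<in> set_pmf (\<pi> h') \<and> c \<in> set_pmf (mnl_choice v S))"
  by auto

lemma policy_start:
  "epoch_start h \<Longrightarrow> S \<in> set_pmf (\<pi> h) \<Longrightarrow>
    is_arg_max (revenue r (v_ucb N h (completed_epochs h))) (\<lambda>S'. S' \<in> F) S"
  using policy unfolding mnl_ucb_policy_def epoch_start_def by (auto dest: spec[of _ h])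

lemma policy_continue: "\<not> epoch_start h \<Longrightarrow> \<pi> h = return_pmf (fst (last h))"
  using policy unfolding mnl_ucb_policy_def epoch_start_def by (auto dest: spec[of _ h])

lemma reachable_entries:
  "h \<in> reachable t \<Longrightarrow> length h = t \<and> (\<forall>x\<in>set h. fst x \<in> F \<and> snd x \<in> insert 0 (fst x))"
proof (induction t arbitrary: h)
  case (Suc t)
  then obtain h' S c where h: "h = h' @ [(S, c)]" "h' \<in> reachable t" "S \<in> set_pmf (\<pi> h')"
    "c \<in> set_pmf (mnl_choice v S)"
    unfolding reachable_Suc by blast
  have "S \<in> F"
  proof (cases "epoch_start h'")
    case True
    then show ?thesis using policy_start h(3) by (auto simp: is_arg_max_def)
  next
    case False
    then have "S = fst (last h')" "h' \<noteq> []" using policy_continue h(3) by (auto simp: epoch_start_def)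
    then show ?thesis using Suc.IH[OF h(2)] last_in_set by blast
  qed
  then show ?case using h Suc.IH[OF h(2)] set_choice by auto
qed simp

lemma length_reachable: "h \<in> reachable t \<Longrightarrow> length h = t"
  using reachable_entries by blast

lemma policy_in_F:
  assumes "h \<in> reachable t" "S \<in> set_pmf (\<pi> h)"
  shows "S \<in> F"
proof -
  obtain c where "c \<in> set_pmf (mnl_choice v S)" using set_pmf_not_empty by fast
  then have "h @ [(S, c)] \<in> reachable (Suc t)" using assms by (subst reachable_Suc) blast
  then show ?thesis using reachable_entries[of "h @ [(S, c)]" "Suc t"] by auto
qed

lemma reachable_induct [consumes 1, case_names Nil snoc]:
  assumes "h \<in> reachable t"
    and "P []"
    and "\<And>t h S c. h \<in> reachable t \<Longrightarrow> P h \<Longrightarrow> S \<in> set_pmf (\<pi> h) \<Longrightarrow> S \<in> F \<Longrightarrow> c \<in> insert 0 S \<Longrightarrow>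
      P (h @ [(S, c)])"
  shows "P h"
  using assms(1)
proof (induction t arbitrary: h)
  case 0
  then show ?case using assms(2) by simp
next
  case (Suc t)
  then obtain h' S c where h: "h = h' @ [(S, c)]" "h' \<in> reachable t" "S \<in> set_pmf (\<pi> h')"
    "c \<in> set_pmf (mnl_choice v S)"
    unfolding reachable_Suc by blast
  then show ?case
    using assms(3)[of h' t S c] Suc.IH[OF h(2)] policy_in_F[OF h(2,3)] set_choice by blast
qed

lemma finite_policy: "h \<in> reachable t \<Longrightarrow> finite (set_pmf (\<pi> h))"
  using policy_in_F finite_F by (meson finite_subset subsetI)

lemma finite_reachable: "finite (reachable t)"
proof (induction t)
  case (Suc t)
  have "reachable (Suc t) =
    (\<Union>h\<in>reachable t. \<Union>S\<in>set_pmf (\<pi> h). (\<lambda>c. h @ [(S, c)]) ` set_pmf (mnl_choice v S))"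
    by auto
  then show ?case
    using Suc finite_policy finite_choice policy_in_F by (auto intro!: finite_UN_I)
qed simp

lemma integrable_trajectory: "integrable (measure_pmf (trajectory v \<pi> t)) (f :: history \<Rightarrow> real)"
  by (intro integrable_measure_pmf_finite finite_reachable)

lemma expect_Suc:
  fixes f :: "history \<Rightarrow> real"
  shows "expect (Suc t) f = expect t (\<lambda>h. measure_pmf.expectation (\<pi> h) (\<lambda>S.
    measure_pmf.expectation (mnl_choice v S) (\<lambda>c. f (h @ [(S, c)]))))"
proof -
  have 1: "finite (set_pmf (bind_pmf (\<pi> h) (\<lambda>S. map_pmf (\<lambda>c. h @ [(S, c)]) (mnl_choice v S))))"
    if "h \<in> reachable t" for h
    using finite_policy[OF that] finite_choice policy_in_F[OF that] by auto
  show ?thesis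
    unfolding trajectory.simps using 1 finite_policy finite_choice policy_in_F
    by (simp add: expectation_bind_finite finite_reachable cong: expectation_cong_pmf)
qed

lemma expect_step_le:
  fixes f g :: "history \<Rightarrow> real"
  assumes "\<And>h S. h \<in> reachable t \<Longrightarrow> S \<in> set_pmf (\<pi> h) \<Longrightarrow> S \<in> F \<Longrightarrow>
    measure_pmf.expectation (mnl_choice v S) (\<lambda>c. f (h @ [(S, c)])) \<le> g h"
  shows "expect (Suc t) f \<le> expect t g"
proof -
  have "measure_pmf.expectation (\<pi> h) (\<lambda>S.
    measure_pmf.expectation (mnl_choice v S) (\<lambda>c. f (h @ [(S, c)]))) \<le> g h" if h: "h \<in> reachable t" for h
  proof -
    have "measure_pmf.expectation (\<pi> h) (\<lambda>S.
      measure_pmf.expectation (mnl_choice v S) (\<lambda>c. f (h @ [(S, c)]))) \<le>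
      measure_pmf.expectation (\<pi> h) (\<lambda>S. g h)"
      using assms h policy_in_F[OF h] by (intro expectation_mono_finite finite_policy[OF h]) auto
    then show ?thesis by simp
  qed
  then show ?thesis unfolding expect_Suc by (intro expectation_mono_finite finite_reachable)
qed

lemma expect_supermartingale:
  fixes f :: "history \<Rightarrow> real"
  assumes "\<And>t h S. h \<in> reachable t \<Longrightarrow> S \<in> set_pmf (\<pi> h) \<Longrightarrow> S \<in> F \<Longrightarrow>
    measure_pmf.expectation (mnl_choice v S) (\<lambda>c. f (h @ [(S, c)])) \<le> f h"
  shows "expect t f \<le> f []"
proof (induction t)
  case (Suc t)
  then show ?case using expect_step_le[of t f f] assms by force
qed simp

text \<open>The difference of the two path sums is a supermartingale starting at 0, so it suffices
  to compare conditional expectations at each step.\<close>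

lemma expect_path_sum_le:
  fixes f g :: "history \<Rightarrow> nat set \<times> nat \<Rightarrow> real"
  assumes "\<And>t h S. h \<in> reachable t \<Longrightarrow> S \<in> set_pmf (\<pi> h) \<Longrightarrow> S \<in> F \<Longrightarrow>
    measure_pmf.expectation (mnl_choice v S) (\<lambda>c. f h (S, c)) \<le>
    measure_pmf.expectation (mnl_choice v S) (\<lambda>c. g h (S, c))"
  shows "expect t (path_sum f) \<le> expect t (path_sum g)"
proof -
  have "expect t (\<lambda>h. path_sum f h - path_sum g h) \<le> path_sum f [] - path_sum g []"
  proof (rule expect_supermartingale)
    fix t h S assume h: "h \<in> reachable t" "S \<in> set_pmf (\<pi> h)" "S \<in> F"
    have [simp]: "integrable (measure_pmf (mnl_choice v S)) k" for k :: "nat \<Rightarrow> real"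
      using h finite_choice by (intro integrable_measure_pmf_finite)
    have "measure_pmf.expectation (mnl_choice v S)
       (\<lambda>c. path_sum f (h @ [(S, c)]) - path_sum g (h @ [(S, c)])) =
       measure_pmf.expectation (mnl_choice v S)
       (\<lambda>c. (path_sum f h - path_sum g h) + (f h (S, c) - g h (S, c)))"
      by (simp add: algebra_simps)
    also have "\<dots> = (path_sum f h - path_sum g h) + (measure_pmf.expectation (mnl_choice v S) (\<lambda>c. f h (S, c))
       - measure_pmf.expectation (mnl_choice v S) (\<lambda>c. g h (S, c)))"
      by (subst Bochner_Integration.integral_add) simp_all
    also have "\<dots> \<le> path_sum f h - path_sum g h" using assms[OF h] by simp
    finally show "measure_pmf.expectation (mnl_choice v S)
       (\<lambda>c. path_sum f (h @ [(S, c)]) - path_sum g (h @ [(S, c)])) \<le> path_sum f h - path_sum g h" .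
  qed
  then show ?thesis by (simp add: integrable_trajectory)
qed

text \<open>An epoch ends at a step with probability \<open>1 / weight S\<close>, so charging \<open>loss S\<close> at
  the end of each epoch has the same expectation as charging the regret at each step.\<close>

lemma regret_le_expected_loss:
  "regret F r v \<pi> T \<le> expect T (path_sum (\<lambda>h x. of_bool (snd x = 0) * loss (fst x)))"
proof -
  have "regret F r v \<pi> T = (\<Sum>t=1..T. expect T (\<lambda>h. Rstar - revenue r v (offered h t)))"
    unfolding regret_def Rstar_def by (simp add: integrable_trajectory)
  also have "\<dots> = expect T (\<lambda>h. \<Sum>t=1..T. Rstar - revenue r v (offered h t))"
    by (rule Bochner_Integration.integral_sum[symmetric]) (rule integrable_trajectory)
  also have "\<dots> = expect T (path_sum (\<lambda>h x. Rstar - revenue r v (fst x)))"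
  proof (rule expectation_cong_pmf)
    fix h assume "h \<in> reachable T"
    then have "length h = T" by (rule length_reachable)
    then show "(\<Sum>t=1..T. Rstar - revenue r v (offered h t)) = path_sum (\<lambda>h x. Rstar - revenue r v (fst x)) h"
      unfolding path_sum_def offered_def
      by (intro sum.reindex_bij_witness[of _ Suc "\<lambda>t. t - 1"]) auto
  qed
  also have "\<dots> \<le> expect T (path_sum (\<lambda>h x. of_bool (snd x = 0) * loss (fst x)))"
  proof (rule expect_path_sum_le)
    fix t h S assume h: "h \<in> reachable t" "S \<in> set_pmf (\<pi> h)" "S \<in> F"
    \<comment> \<open>Only the outcome 0 contributes on the right, with probability
      \<open>1 / weight S\<close>, which cancels the factor \<open>weight S\<close> in
      \<open>loss S\<close>.\<close>
    have "(\<Sum>i\<in>S. v i * of_bool (i = 0)) = 0"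
      using zero_notin[OF h(3)] by (intro sum.neutral) (auto simp: of_bool_def)
    then show "measure_pmf.expectation (mnl_choice v S) (\<lambda>c. Rstar - revenue r v (fst (S, c))) \<le>
      measure_pmf.expectation (mnl_choice v S) (\<lambda>c. of_bool (snd (S, c) = 0) * loss (fst (S, c)))"
      using weight_ge[OF h(3)] by (simp add: expectation_choice[OF h(3)] loss_def)
  qed
  finally show ?thesis .
qed

section \<open>Failure of the confidence bounds\<close>

text \<open>Until \<open>l\<close> epochs are completed, \<open>z ^ purchases i * q ^ epochs_with i\<close> with
  \<open>q = 1 - v i * (z - 1)\<close> is a martingale: a step in which \<open>i\<close> is offered multiplies it by \<open>z\<close>, \<open>q\<close>
  or \<open>1\<close> with probabilities proportional to \<open>v i\<close>, \<open>1\<close> and the remaining weight.\<close>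

lemma expected_deviations_le:
  assumes i: "i \<in> {1..N}" and z: "z > 0" and q: "1 - v i * (z - 1) > 0" and K: "K \<ge> 0" and l: "l \<ge> 1"
    and X: "\<And>C. X C \<Longrightarrow> 1 \<le> K * z ^ C * (1 - v i * (z - 1)) ^ n"
  shows "expect T (path_sum (\<lambda>h x. of_bool (snd x = 0 \<and> completed_epochs h = l \<and>
    epochs_with i h = n \<and> X (purchases i (current_start h))))) \<le> K"
proof -
  define q where "q = 1 - v i * (z - 1)"
  define f where "f = (\<lambda>h (x :: nat set \<times> nat). of_bool (snd x = 0 \<and> completed_epochs h = l \<and>
    epochs_with i h = n \<and> X (purchases i (current_start h))) :: real)"
  define W where "W h = K * z ^ purchases i h * q ^ epochs_with i h" for h
  \<comment> \<open>The event concerns the data after \<open>l\<close> epochs but is charged only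
    when the next epoch ends. Meanwhile its indicator is kept as a pending term; after the charge
    that term is 0 and \<open>pot\<close> stays constant.\<close>
  define pot where "pot h = path_sum f h + (if completed_epochs h < l then W h else
    of_bool (completed_epochs h = l \<and> epochs_with i h = n \<and> X (purchases i (current_start h))))" for h
  have q0: "q > 0" using q by (simp add: q_def)
  have W0: "W h \<ge> 0" for h using K z q0 by (simp add: W_def)
  have "expect T pot \<le> pot []"
  proof (rule expect_supermartingale)
    fix t h S assume h: "h \<in> reachable t" "S \<in> set_pmf (\<pi> h)" "S \<in> F"
    show "measure_pmf.expectation (mnl_choice v S) (\<lambda>c. pot (h @ [(S, c)])) \<le> pot h"
    proof (cases "completed_epochs h < l")
      case True
      define m where "m c = (if c = i then z else if c = 0 \<and> i \<in> S then q else 1)" for c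
      have "pot (h @ [(S, c)]) \<le> path_sum f h + W h * m c" for c
      proof -
        have "of_bool (n' = n \<and> X C) \<le> K * z ^ C * q ^ n'" for n' C
          using X[of C] K z q0 by (auto simp: q_def[symmetric])
        then have le: "of_bool (epochs_with i h' = n \<and> X (purchases i h')) \<le> W h'" for h'
          by (simp add: W_def)
        have eq: "W (h @ [(S, c)]) = W h * m c"
          using i by (auto simp: W_def m_def)
        \<comment> \<open>\<open>f\<close> charges nothing yet. If this step completes epoch
          \<open>l\<close>, then \<open>current_start\<close> is the whole new history, and
          \<open>W\<close> dominates the pending indicator.\<close>
        have "pot (h @ [(S, c)]) \<le> path_sum f h + W (h @ [(S, c)])"
          using True le[of "h @ [(S, c)]"] W0[of "h @ [(S, c)]"]
          by (auto simp: pot_def f_def current_start_snoc split: if_splits)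
        then show ?thesis using eq by simp
      qed
      then have "measure_pmf.expectation (mnl_choice v S) (\<lambda>c. pot (h @ [(S, c)])) \<le>
        measure_pmf.expectation (mnl_choice v S) (\<lambda>c. path_sum f h + W h * m c)"
        by (intro expectation_mono_finite finite_choice h)
      also have "\<dots> = path_sum f h + W h * measure_pmf.expectation (mnl_choice v S) m"
        using finite_choice[OF h(3)] by (simp add: integrable_measure_pmf_finite)
      also have "measure_pmf.expectation (mnl_choice v S) m = 1"
      proof -
        have "m 0 + (\<Sum>j\<in>S. v j * m j) = weight S"
        proof (cases "i \<in> S")
          case True
          have "(\<Sum>j\<in>S. v j * m j) = (\<Sum>j\<in>S. v j + (if j = i then v i * (z - 1) else 0))"
            using zero_notin[OF h(3)] by (intro sum.cong) (auto simp: m_def algebra_simps)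
          also have "\<dots> = (\<Sum>j\<in>S. v j) + v i * (z - 1)"
            using True finite_assortment[OF h(3)] by (simp add: sum.distrib)
          finally show ?thesis using True i by (simp add: m_def q_def weight_def)
        next
          case False
          then have "(\<Sum>j\<in>S. v j * m j) = (\<Sum>j\<in>S. v j)"
            by (intro sum.cong) (auto simp: m_def)
          then show ?thesis using False i by (simp add: m_def weight_def)
        qed
        then show ?thesis using weight_ge[OF h(3)] by (simp add: expectation_choice[OF h(3)])
      qed
      finally show ?thesis using True by (simp add: pot_def)
    next
      case False
      then have "pot (h @ [(S, c)]) = pot h" for c
        by (auto simp: pot_def f_def current_start_snoc)
      then show ?thesis by simp
    qed
  qed
  moreover have "expect T (path_sum f) \<le> expect T pot"
    by (intro expectation_mono_finite finite_reachable) (auto simp: pot_def W0)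
  moreover have "pot [] = K" using l by (simp add: pot_def W_def)
  ultimately show ?thesis by (simp add: f_def)
qed

section \<open>Indices of the algorithm on reachable histories\<close>

lemma reachable_coherent: "h \<in> reachable t \<Longrightarrow> coherent h"
proof (induction rule: reachable_induct)
  case Nil
  then show ?case by (simp add: coherent_def)
next
  case (snoc t h S c)
  then show ?case using policy_continue[of h] by (intro coherent_snoc) auto
qed

lemma v_ucb_eq:
  assumes h: "h \<in> reachable t" "epoch_start h" and i: "i \<in> {1..N}"
  shows "v_ucb N h (completed_epochs h) i =
    ucb (log_level N (completed_epochs h)) (epochs_with i h) (purchases i h)"
proof -
  have "(\<Sum>\<tau>\<in>offer_epochs h i (completed_epochs h). v_hat h i \<tau>) = purchases i h"
    using reachable_entries[OF h(1)] i by (intro sum_v_hat_eq reachable_coherent[OF h(1)] h(2)) force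
  then show ?thesis
    using offer_count_eq[OF reachable_coherent[OF h(1)] h(2)]
    by (simp add: v_ucb_def v_bar_def ucb_def log_level_def)
qed

text \<open>Lets a step in the middle of an epoch be analysed at the start of that epoch, where the
  assortment was selected as a maximiser. The two epoch counters agree because they change only at
  closing steps.\<close>

lemma current_start_invariant:
  assumes "h \<in> reachable t"
  shows "(\<exists>t0. current_start h \<in> reachable t0) \<and> epoch_start (current_start h) \<and>
    completed_epochs (current_start h) = completed_epochs h \<and>
    (\<forall>i. epochs_with i (current_start h) = epochs_with i h) \<and>
    set_pmf (\<pi> h) \<subseteq> set_pmf (\<pi> (current_start h))"
  using assms
proof (induction rule: reachable_induct)
  case Nil
  have "[] \<in> reachable 0" by simp
  moreover have "current_start [] = []" "epoch_start []"
    by (simp_all add: current_start_def epoch_start_def)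
  ultimately show ?case by (metis order_refl)
next
  case (snoc t h S c)
  show ?case
  proof (cases "c = 0")
    case True
    have "c \<in> set_pmf (mnl_choice v S)"
      using True snoc.hyps weight_ge[of S] by (simp add: set_pmf_iff pmf_choice v0)
    then have "h @ [(S, c)] \<in> reachable (Suc t)" using snoc.hyps by (subst reachable_Suc) blast
    then show ?thesis using True by (auto simp: current_start_snoc epoch_start_def simp del: trajectory.simps)
  next
    case False
    then have "\<pi> (h @ [(S, c)]) = return_pmf S"
      using policy_continue[of "h @ [(S, c)]"] by (simp add: epoch_start_def)
    then show ?thesis using False snoc by (auto simp: current_start_snoc)
  qed
qed

section \<open>Optimism and regret\<close>

lemma best_assortment: "best_assortment F r v \<in> F" "S \<in> F \<Longrightarrow> revenue r v S \<le> Rstar"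
  using best_assortment_is_arg_max[OF finite_F F_nonempty, of r v]
  by (auto simp: is_arg_max_def Rstar_def not_less)

lemma revenue_nonneg: "S \<in> F \<Longrightarrow> 0 \<le> revenue r v S"
  unfolding revenue_def using F_sub[of S] r v_pos[of S] weight_ge[of S]
  by (intro divide_nonneg_nonneg sum_nonneg mult_nonneg_nonneg)
    (auto simp: weight_def less_imp_le subset_iff)

lemma Rstar_nonneg: "0 \<le> Rstar"
  unfolding Rstar_def by (intro revenue_nonneg best_assortment)

lemma sum_revenue_eq: "S \<in> F \<Longrightarrow> (\<Sum>i\<in>S. r i * v i) = revenue r v S * weight S"
  using weight_ge[of S] by (simp add: revenue_def weight_def)

lemma revenue_le_1: "S \<in> F \<Longrightarrow> revenue r v S \<le> 1"
proof -
  assume S: "S \<in> F"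
  have "(\<Sum>i\<in>S. r i * v i) \<le> (\<Sum>i\<in>S. v i)"
    using F_sub[OF S] r v_pos[OF S]
    by (intro sum_mono mult_left_le_one_le) (auto simp: less_imp_le subset_iff)
  then have "revenue r v S * weight S \<le> 1 * weight S"
    unfolding sum_revenue_eq[OF S, symmetric] by (simp add: weight_def)
  then show ?thesis using weight_ge[OF S] by (simp add: mult_le_cancel_right)
qed

lemma Rstar_le_1: "Rstar \<le> 1"
  unfolding Rstar_def by (intro revenue_le_1 best_assortment)

lemma loss_le: "S \<in> F \<Longrightarrow> loss S \<le> N + 1"
proof -
  assume S: "S \<in> F"
  have "loss S \<le> weight S * 1"
    unfolding loss_def using weight_ge[OF S] revenue_nonneg[OF S] Rstar_le_1 by (intro mult_left_mono) auto
  then show ?thesis using weight_le[OF S] by simp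
qed

text \<open>Dropping a product with revenue below \<open>Rstar\<close> would improve an optimal assortment.\<close>

lemma revenue_best_product_ge:
  assumes i: "i \<in> best_assortment F r v"
  shows "Rstar \<le> r i"
proof (rule ccontr)
  define S where "S = best_assortment F r v"
  assume "\<not> Rstar \<le> r i"
  have S: "S \<in> F" and S': "S - {i} \<in> F"
    using best_assortment(1) F_down[of S "S - {i}"] by (auto simp: S_def)
  have iS: "i \<in> S" using i by (simp add: S_def)
  have w: "weight (S - {i}) = weight S - v i"
    unfolding weight_def using iS finite_assortment[OF S] by (simp add: sum_diff1)
  have "(\<Sum>j\<in>S - {i}. r j * v j) = Rstar * weight S - r i * v i"
    using iS finite_assortment[OF S] sum_revenue_eq[OF S] by (simp add: sum_diff1 Rstar_def S_def)
  also have "\<dots> > Rstar * weight S - Rstar * v i"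
    using \<open>\<not> Rstar \<le> r i\<close> v_pos[OF S iS] by simp
  also have "Rstar * weight S - Rstar * v i = Rstar * weight (S - {i})"
    by (simp add: w algebra_simps)
  finally have "Rstar < revenue r v (S - {i})"
    using sum_revenue_eq[OF S'] weight_ge[OF S'] by simp
  then show False using best_assortment(2)[OF S'] by simp
qed

text \<open>Products of an optimal assortment have revenue at least \<open>Rstar\<close>, so raising
  their parameters from \<open>v\<close> to \<open>u\<close> keeps its revenue at least
  \<open>Rstar\<close>. The maximiser \<open>S\<close> under \<open>u\<close> inherits this bound;
  clearing denominators isolates \<open>loss S\<close>.\<close>

lemma loss_le_optimistic:
  assumes S: "is_arg_max (revenue r u) (\<lambda>S'. S' \<in> F) S"
    and u: "\<And>i. i \<in> {1..N} \<Longrightarrow> v i \<le> u i"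
  shows "loss S \<le> (\<Sum>j\<in>S. u j - v j)"
proof -
  define B where "B = best_assortment F r v"
  have SF: "S \<in> F" and BF: "B \<in> F" and le: "revenue r u B \<le> revenue r u S"
    using S best_assortment(1) by (auto simp: is_arg_max_def B_def not_less)
  have uv: "v i \<le> u i" "0 \<le> r i" "r i \<le> 1" if "S' \<in> F" "i \<in> S'" for S' i
    using that F_sub[of S'] u r by blast+
  have wu: "1 + (\<Sum>j\<in>S'. u j) = weight S' + (\<Sum>j\<in>S'. u j - v j)" for S'
    by (simp add: weight_def sum_subtractf)
  have wu_pos: "1 + (\<Sum>j\<in>S'. u j) > 0" if "S' \<in> F" for S'
    unfolding wu using weight_ge[OF that] uv[OF that] by (auto intro!: add_pos_nonneg sum_nonneg)
  have ru: "(\<Sum>j\<in>S'. r j * u j) = (\<Sum>j\<in>S'. r j * v j) + (\<Sum>j\<in>S'. r j * (u j - v j))" for S'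
    by (simp add: sum.distrib[symmetric] algebra_simps)
  have "Rstar * (\<Sum>j\<in>B. u j - v j) \<le> (\<Sum>j\<in>B. r j * (u j - v j))"
    unfolding sum_distrib_left using revenue_best_product_ge uv[OF BF]
    by (intro sum_mono mult_right_mono) (auto simp: B_def)
  then have "Rstar * (1 + (\<Sum>j\<in>B. u j)) \<le> (\<Sum>j\<in>B. r j * u j)"
    unfolding wu ru sum_revenue_eq[OF BF] by (simp add: Rstar_def B_def algebra_simps)
  then have "Rstar \<le> revenue r u B"
    using wu_pos[OF BF] by (simp add: revenue_def field_simps)
  then have "Rstar \<le> revenue r u S" using le by simp
  then have "Rstar * (1 + (\<Sum>j\<in>S. u j)) \<le> (\<Sum>j\<in>S. r j * u j)"
    using wu_pos[OF SF] by (simp add: revenue_def field_simps)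
  then have "loss S \<le> (\<Sum>j\<in>S. r j * (u j - v j)) - Rstar * (\<Sum>j\<in>S. u j - v j)"
    unfolding wu ru sum_revenue_eq[OF SF] by (simp add: loss_def algebra_simps)
  also have "\<dots> \<le> (\<Sum>j\<in>S. r j * (u j - v j))"
    using Rstar_nonneg uv[OF SF] by (simp add: sum_nonneg)
  also have "\<dots> \<le> (\<Sum>j\<in>S. u j - v j)"
    using uv[OF SF] by (intro sum_mono mult_left_le_one_le) auto
  finally show ?thesis .
qed

text \<open>Purchases are read at the start of the epoch in progress, since the current assortment
  was selected with those data. Products without a completed epoch have index 1, which is always a
  valid bound.\<close>

definition bad :: "history \<Rightarrow> bool" where
  "bad h \<longleftrightarrow> (\<exists>i\<in>{1..N}. epochs_with i h \<ge> 1 \<and>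
    (over_dev (v i) (log_level N (completed_epochs h)) (epochs_with i h) (purchases i (current_start h)) \<or>
     under_dev (v i) (log_level N (completed_epochs h)) (epochs_with i h) (purchases i (current_start h))))"

text \<open>The loss charged to a product that was offered in \<open>n\<close> earlier epochs.\<close>

definition charge :: "nat \<Rightarrow> real \<Rightarrow> nat \<Rightarrow> real" where
  "charge T \<Delta> n = (if n < log_level N T then N + 1
    else max 0 (200 * sqrt (log_level N T) / sqrt n - \<Delta> / N))"

lemma charge_nonneg: "charge T \<Delta> n \<ge> 0"
  by (simp add: charge_def)

text \<open>Four cases: a failed confidence bound costs \<open>N + 1\<close>; an insufficiently
  explored product pays the whole loss; an optimal assortment has no loss; otherwise optimism
  applies and the loss is at least \<open>\<Delta>\<close>.\<close>

lemma loss_le_charge: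
  assumes h: "h \<in> reachable t" "t < T" and S: "S \<in> set_pmf (\<pi> h)"
    and \<Delta>: "\<Delta> > 0" "\<And>S. S \<in> F \<Longrightarrow> revenue r v S \<noteq> Rstar \<Longrightarrow> \<Delta> \<le> Rstar - revenue r v S"
  shows "loss S \<le> (N + 1) * of_bool (bad h) + (\<Sum>j\<in>S. charge T \<Delta> (epochs_with j h))"
proof -
  have SF: "S \<in> F" using policy_in_F h(1) S by blast
  define l where "l = completed_epochs h"
  define u where "u = v_ucb N (current_start h) l"
  define C where "C i = purchases i (current_start h)" for i
  obtain t0 where h0: "current_start h \<in> reachable t0" "epoch_start (current_start h)"
    "completed_epochs (current_start h) = l" "\<And>i. epochs_with i (current_start h) = epochs_with i h"
    "S \<in> set_pmf (\<pi> (current_start h))"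
    using current_start_invariant[OF h(1)] S unfolding l_def by blast
  have u_eq: "u i = ucb (log_level N l) (epochs_with i h) (C i)" if "i \<in> {1..N}" for i
    using v_ucb_eq[OF h0(1,2) that] unfolding u_def C_def h0(3,4) .
  have nonneg: "(\<Sum>j\<in>S. charge T \<Delta> (epochs_with j h)) \<ge> 0" by (intro sum_nonneg charge_nonneg)
  have lT: "l \<le> T" using completed_epochs_le[of h] length_reachable[OF h(1)] h(2) by (simp add: l_def)
  consider "bad h" | "\<not> bad h" "\<exists>j\<in>S. epochs_with j h < log_level N T" | "loss S = 0"
    | "\<not> bad h" "\<forall>j\<in>S. log_level N T \<le> epochs_with j h" "loss S \<noteq> 0"
    by force
  then show ?thesis
  proof cases
    case 1
    then show ?thesis using loss_le[OF SF] nonneg by simp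
  next
    case 2
    then obtain j where j: "j \<in> S" "epochs_with j h < log_level N T" by blast
    have "loss S \<le> charge T \<Delta> (epochs_with j h)"
      using loss_le[OF SF] j by (simp add: charge_def)
    also have "\<dots> \<le> (\<Sum>j\<in>S. charge T \<Delta> (epochs_with j h))"
      using j finite_assortment[OF SF] by (intro member_le_sum charge_nonneg) auto
    finally show ?thesis using 2 by simp
  next
    case 3
    then show ?thesis using nonneg by simp
  next
    case 4
    have good: "epochs_with i h = 0 \<or> \<not> over_dev (v i) (log_level N l) (epochs_with i h) (C i) \<and>
      \<not> under_dev (v i) (log_level N l) (epochs_with i h) (C i)" if "i \<in> {1..N}" for i
      using 4(1) that unfolding bad_def l_def C_def by (metis One_nat_def Suc_leI neq0_conv)
    have ge: "v i \<le> u i" if i: "i \<in> {1..N}" for i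
    \<comment> \<open>Before the first completed epoch the level is \<open>ln 1 = 0\<close>, so the
      confidence lemma does not apply, but every index is 1.\<close>
    proof (cases "l = 0")
      case True
      then show ?thesis using epochs_with_le[of i h] v[OF i] u_eq[OF i] by (simp add: l_def ucb_def)
    next
      case False
      then show ?thesis unfolding u_eq[OF i] using v[OF i] good[OF i] N
        by (intro ucb_ge log_level_pos) auto
    qed
    have gap_le: "\<Delta> \<le> loss S"
    proof -
      have "revenue r v S \<noteq> Rstar" using 4 by (auto simp: loss_def)
      then have "\<Delta> \<le> 1 * (Rstar - revenue r v S)" using \<Delta>(2) SF by simp
      also have "\<dots> \<le> loss S"
        unfolding loss_def using weight_ge[OF SF] best_assortment(2)[OF SF] by (intro mult_right_mono) auto
      finally show ?thesis .
    qed
    have dev: "u j - v j \<le> 100 * (sqrt (log_level N T) / sqrt (epochs_with j h))" if j: "j \<in> S" for j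
    proof -
      have jN: "j \<in> {1..N}" using F_sub SF j by blast
      have pos: "epochs_with j h > 0"
        using 4(2) j log_level_pos[OF N, of T] h(2) by (cases "epochs_with j h") fastforce+
      then have l: "l \<ge> 1" using epochs_with_le[of j h] by (simp add: l_def)
      have mono: "log_level N l \<le> log_level N T" using lT by (rule log_level_mono)
      have "u j \<le> v j + 100 * sqrt (log_level N l / epochs_with j h)"
        unfolding u_eq[OF jN] using v[OF jN] good[OF jN] pos l N 4(2) j mono
        by (intro ucb_le log_level_pos) auto
      also have "sqrt (log_level N l / epochs_with j h) \<le> sqrt (log_level N T / epochs_with j h)"
        using mono by (intro real_sqrt_le_mono divide_right_mono) auto
      finally show ?thesis by (simp add: real_sqrt_divide)
    qed
    have "is_arg_max (revenue r u) (\<lambda>S'. S' \<in> F) S"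
      using policy_start[OF h0(2,5)] unfolding u_def h0(3) .
    then have "loss S \<le> (\<Sum>j\<in>S. u j - v j)" using ge by (rule loss_le_optimistic)
    also have "\<dots> \<le> (\<Sum>j\<in>S. 100 * (sqrt (log_level N T) / sqrt (epochs_with j h)))"
      using dev by (intro sum_mono)
    \<comment> \<open>From \<open>loss S <= X\<close> and \<open>\<Delta> <= loss S\<close> follows
      \<open>loss S <= 2 * X - \<Delta>\<close>; the subtracted gap is then distributed over the at
      most \<open>N\<close> products of \<open>S\<close>.\<close>
    finally have "loss S \<le> 2 * (\<Sum>j\<in>S. 100 * (sqrt (log_level N T) / sqrt (epochs_with j h))) - \<Delta>"
      using gap_le by simp
    also have "\<dots> \<le> 2 * (\<Sum>j\<in>S. 100 * (sqrt (log_level N T) / sqrt (epochs_with j h))) - (\<Sum>j\<in>S. \<Delta> / N)"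
    proof -
      have "card S \<le> N" using card_mono[OF _ F_sub[OF SF]] by simp
      then have "(\<Sum>j\<in>S. \<Delta> / N) \<le> \<Delta>" using \<Delta>(1) N by (simp add: field_simps)
      then show ?thesis by simp
    qed
    also have "\<dots> = (\<Sum>j\<in>S. 200 * sqrt (log_level N T) / sqrt (epochs_with j h) - \<Delta> / N)"
      by (simp add: sum_distrib_left sum_subtractf)
    also have "\<dots> \<le> (\<Sum>j\<in>S. charge T \<Delta> (epochs_with j h))"
      using 4(2) by (intro sum_mono) (auto simp: charge_def)
    finally show ?thesis using 4 by simp
  qed
qed

text \<open>Each closing step of an epoch offering \<open>j\<close> raises the counter of
  \<open>j\<close> by one, so along a path product \<open>j\<close> pays \<open>f n\<close> exactly
  once for each \<open>n\<close> below its final count.\<close>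

lemma path_sum_charge:
  assumes "h \<in> reachable t"
  shows "path_sum (\<lambda>h x. of_bool (snd x = 0) * (\<Sum>j\<in>fst x. f (epochs_with j h))) h =
    (\<Sum>j=1..N. \<Sum>n<epochs_with j h. f n)"
  using assms
proof (induction rule: reachable_induct)
  case (snoc t h S c)
  show ?case
  proof (cases "c = 0")
    case True
    have "(\<Sum>j\<in>{1..N}. \<Sum>n<epochs_with j h + of_bool (j \<in> S). f n) =
      (\<Sum>j\<in>{1..N}. (\<Sum>n<epochs_with j h. f n) + (if j \<in> S then f (epochs_with j h) else 0))"
      by (intro sum.cong) auto
    also have "\<dots> = (\<Sum>j\<in>{1..N}. \<Sum>n<epochs_with j h. f n) + (\<Sum>j\<in>{1..N} \<inter> S. f (epochs_with j h))"
      by (simp add: sum.distrib sum.inter_restrict)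
    also have "{1..N} \<inter> S = S" using F_sub[OF snoc.hyps(3)] by blast
    finally show ?thesis using True snoc by simp
  qed (use snoc in simp)
qed simp

lemma path_loss_le:
  assumes "h \<in> reachable t"
    and \<Delta>: "\<Delta> > 0" "\<And>S. S \<in> F \<Longrightarrow> revenue r v S \<noteq> Rstar \<Longrightarrow> \<Delta> \<le> Rstar - revenue r v S"
  shows "length h \<le> T \<Longrightarrow> path_sum (\<lambda>h x. of_bool (snd x = 0) * loss (fst x)) h \<le>
    (N + 1) * path_sum (\<lambda>h x. of_bool (snd x = 0 \<and> bad h)) h +
    path_sum (\<lambda>h x. of_bool (snd x = 0) * (\<Sum>j\<in>fst x. charge T \<Delta> (epochs_with j h))) h"
  using assms(1)
proof (induction rule: reachable_induct)
  case (snoc t h S c)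
  have "t < T" using length_reachable[OF snoc.hyps(1)] snoc.prems by simp
  then have "loss S \<le> (N + 1) * of_bool (bad h) + (\<Sum>j\<in>S. charge T \<Delta> (epochs_with j h))"
    using loss_le_charge[OF snoc.hyps(1) _ snoc.hyps(2) \<Delta>] by blast
  then show ?case using snoc.IH snoc.prems by (cases "c = 0") (simp_all add: ring_distribs)
qed simp

text \<open>At most \<open>\<Lambda> + 1\<close> counts lie below the level. The others are summed
  with \<open>a = 200 * sqrt \<Lambda>\<close> and \<open>d = \<Delta> / N\<close>, so
  \<open>2 * a^2 / d\<close> yields the constant 80000. The count 0 is always below the level, as
  \<open>\<Lambda> > 0\<close>.\<close>

lemma sum_charge_le:
  assumes \<Delta>: "\<Delta> > 0" and T: "T \<ge> 1"
  shows "(\<Sum>n<M. charge T \<Delta> n) \<le>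
    (N + 1) * (log_level N T + 1) + 80000 * log_level N T * N / \<Delta>"
proof -
  define \<Lambda> where "\<Lambda> = log_level N T"
  have \<Lambda>: "\<Lambda> > 0" using log_level_pos[OF N T] by (simp add: \<Lambda>_def)
  let ?p = "\<lambda>n::nat. max 0 (200 * sqrt \<Lambda> / sqrt n - \<Delta> / N)"
  have "(\<Sum>n<M. charge T \<Delta> n) \<le>
    (\<Sum>n<M. (if n \<in> {n. real n < \<Lambda>} then real (N + 1) else 0) + (if n \<in> {1..} then ?p n else 0))"
    using \<Lambda> by (intro sum_mono) (auto simp: charge_def \<Lambda>_def)
  also have "\<dots> = (\<Sum>n\<in>{..<M} \<inter> {n. real n < \<Lambda>}. real (N + 1)) + (\<Sum>n\<in>{..<M} \<inter> {1..}. ?p n)"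
    unfolding sum.distrib by (simp only: sum.inter_restrict finite_lessThan)
  also have "{..<M} \<inter> {1..} = {1..<M}" by auto
  also have "(\<Sum>n=1..<M. ?p n) \<le> 2 * (200 * sqrt \<Lambda>)\<^sup>2 / (\<Delta> / N)"
    using \<Lambda> \<Delta> N by (intro sum_pos_part_inverse_sqrt_le) auto
  also have "\<dots> = 80000 * \<Lambda> * N / \<Delta>" using \<Lambda> by (simp add: power_mult_distrib)
  also have "(\<Sum>n\<in>{..<M} \<inter> {n. real n < \<Lambda>}. real (N + 1)) \<le> (N + 1) * (\<Lambda> + 1)"
  proof -
    have "card ({..<M} \<inter> {n. real n < \<Lambda>}) \<le> card {..<nat \<lceil>\<Lambda>\<rceil>}"
      by (intro card_mono) (auto simp: less_ceiling_iff zless_nat_eq_int_zless)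
    then have "real (card ({..<M} \<inter> {n. real n < \<Lambda>})) \<le> \<Lambda> + 1"
      using \<Lambda> by simp linarith
    then show ?thesis by (simp add: mult.commute mult_right_mono del: of_nat_add)
  qed
  finally show ?thesis by (simp add: \<Lambda>_def)
qed

text \<open>Union bound over the number \<open>l\<close> of completed epochs, the product
  \<open>i\<close> and its count \<open>n <= l\<close>. For each \<open>l\<close> there are
  \<open>N * l\<close> pairs of probability at most \<open>1 / (N^2 * l^4)\<close>, which sums to at
  most \<open>2 / N\<close> for each kind of deviation.\<close>

lemma expected_bad_le:
  "expect T (path_sum (\<lambda>h x. of_bool (snd x = 0 \<and> bad h))) \<le> 4 / N"
proof -
  define I where "I = (SIGMA l:{1..T}. {1..N} \<times> {1..l})"
  have fin: "finite I" by (simp add: I_def)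
  define f where "f D k h x = (case k of (l, i, n) \<Rightarrow> (of_bool (snd x = 0 \<and> completed_epochs h = l \<and>
    epochs_with i h = n \<and> D (v i) (log_level N l) n (purchases i (current_start h))) :: real))"
    for D k h and x :: "nat set \<times> nat"
  have le: "of_bool (snd x = 0 \<and> bad h) \<le> (\<Sum>k\<in>I. f over_dev k h x) + (\<Sum>k\<in>I. f under_dev k h x)"
    if "length h < T" for h and x :: "nat set \<times> nat"
  proof (cases "snd x = 0 \<and> bad h")
    case True
    then obtain i where i: "i \<in> {1..N}" "epochs_with i h \<ge> 1"
      and D: "over_dev (v i) (log_level N (completed_epochs h)) (epochs_with i h) (purchases i (current_start h)) \<or>
      under_dev (v i) (log_level N (completed_epochs h)) (epochs_with i h) (purchases i (current_start h))"
      unfolding bad_def by blast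
    let ?k = "(completed_epochs h, i, epochs_with i h)"
    have k: "?k \<in> I"
      using i that epochs_with_le[of i h] completed_epochs_le[of h] by (auto simp: I_def)
    have "f D k h x \<ge> 0" for D k by (simp add: f_def split: prod.split)
    then have "f D ?k h x \<le> (\<Sum>k\<in>I. f D k h x)" and "0 \<le> (\<Sum>k\<in>I. f D k h x)" for D
      using k fin by (auto intro!: member_le_sum sum_nonneg)
    from this(1)[of over_dev] this(1)[of under_dev] this(2)[of over_dev] this(2)[of under_dev]
    show ?thesis using True D by (auto simp: f_def)
  next
    case False
    then have "of_bool (snd x = 0 \<and> bad h) = (0 :: real)" by (simp only: of_bool_eq)
    moreover have "f D k h x \<ge> 0" for D k by (simp add: f_def split: prod.split)
    ultimately show ?thesis by (simp only:) (simp add: sum_nonneg)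
  qed
  have each: "expect T (path_sum (f D k)) \<le> 1 / ((real N)\<^sup>2 * real (fst k) ^ 4)"
    if k: "k \<in> I" and D: "D = over_dev \<or> D = under_dev" for k D
  proof -
    obtain l i n where lin: "k = (l, i, n)" "l \<ge> 1" "i \<in> {1..N}" "n \<ge> 1"
      using k by (auto simp: I_def)
    have L: "log_level N l > 0" using log_level_pos N lin by simp
    have vi: "0 < v i" "v i \<le> 1" using v[OF lin(3)] by auto
    obtain z where "z > 0" "1 - v i * (z - 1) > 0"
      "\<And>C. D (v i) (log_level N l) n C \<Longrightarrow> 1 \<le> exp (-4 * log_level N l) * z ^ C * (1 - v i * (z - 1)) ^ n"
      using over_dev_weight[OF vi L, of n] under_dev_weight[OF vi L, of n] D lin(4) by auto
    then have "expect T (path_sum (f D k)) \<le> exp (-4 * log_level N l)"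
      unfolding f_def lin(1) prod.case by (intro expected_deviations_le lin) auto
    also have "\<dots> \<le> 1 / ((real N)\<^sup>2 * real (fst k) ^ 4)" using exp_log_level_le N lin by simp
    finally show ?thesis .
  qed
  have expect_f: "expect T (path_sum (\<lambda>h x. \<Sum>k\<in>I. f D k h x)) \<le> 2 / N"
    if D: "D = over_dev \<or> D = under_dev" for D
  proof -
    have "expect T (path_sum (\<lambda>h x. \<Sum>k\<in>I. f D k h x)) = (\<Sum>k\<in>I. expect T (path_sum (f D k)))"
      unfolding path_sum_sum by (rule Bochner_Integration.integral_sum) (rule integrable_trajectory)
    also have "\<dots> \<le> (\<Sum>k\<in>I. 1 / ((real N)\<^sup>2 * real (fst k) ^ 4))"
      using each D by (intro sum_mono) auto
    also have "\<dots> = (\<Sum>l=1..T. real N * l * (1 / ((real N)\<^sup>2 * real l ^ 4)))"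
    proof -
      have "(\<Sum>k\<in>I. 1 / ((real N)\<^sup>2 * real (fst k) ^ 4)) =
        (\<Sum>(l, p)\<in>I. 1 / ((real N)\<^sup>2 * real l ^ 4))" by (simp add: case_prod_beta)
      also have "\<dots> = (\<Sum>l=1..T. \<Sum>p\<in>{1..N} \<times> {1..l}. 1 / ((real N)\<^sup>2 * real l ^ 4))"
        unfolding I_def by (rule sum.Sigma[symmetric]) auto
      finally show ?thesis by (simp add: card_cartesian_product)
    qed
    also have "\<dots> \<le> (\<Sum>l=1..T. 1 / N * (1 / (real l)\<^sup>2))"
    proof (rule sum_mono)
      fix l assume l: "l \<in> {1..T}"
      have "real N * l * (1 / ((real N)\<^sup>2 * real l ^ 4)) = 1 / N * (1 / real l ^ 3)"
        using l N by (simp add: power2_eq_square power3_eq_cube power4_eq_xxxx)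
      also have "\<dots> \<le> 1 / N * (1 / (real l)\<^sup>2)"
        using l by (intro mult_left_mono divide_left_mono power_increasing) auto
      finally show "real N * l * (1 / ((real N)\<^sup>2 * real l ^ 4)) \<le> 1 / N * (1 / (real l)\<^sup>2)" .
    qed
    also have "\<dots> \<le> 1 / N * 2"
      unfolding sum_distrib_left[symmetric] by (intro mult_left_mono sum_inverse_squares_le) simp
    finally show ?thesis by simp
  qed
  have "expect T (path_sum (\<lambda>h x. of_bool (snd x = 0 \<and> bad h))) \<le>
    expect T (\<lambda>h. path_sum (\<lambda>h x. \<Sum>k\<in>I. f over_dev k h x) h + path_sum (\<lambda>h x. \<Sum>k\<in>I. f under_dev k h x) h)"
  proof (intro expectation_mono_finite finite_reachable)
    fix h assume "h \<in> reachable T"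
    then have "length h = T" by (rule length_reachable)
    then show "path_sum (\<lambda>h x. of_bool (snd x = 0 \<and> bad h)) h \<le>
      path_sum (\<lambda>h x. \<Sum>k\<in>I. f over_dev k h x) h + path_sum (\<lambda>h x. \<Sum>k\<in>I. f under_dev k h x) h"
      unfolding path_sum_def by (subst sum.distrib[symmetric]) (intro sum_mono le, auto)
  qed
  also have "\<dots> \<le> 2 / N + 2 / N"
    using add_mono[OF expect_f[of over_dev] expect_f[of under_dev]]
    by (simp add: integrable_trajectory)
  finally show ?thesis by simp
qed

lemma regret_le_log_level:
  assumes T: "T \<ge> 1"
    and \<Delta>: "\<Delta> > 0" "\<And>S. S \<in> F \<Longrightarrow> revenue r v S \<noteq> Rstar \<Longrightarrow> \<Delta> \<le> Rstar - revenue r v S"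
  shows "regret F r v \<pi> T \<le>
    8 + N * ((N + 1) * (log_level N T + 1) + 80000 * log_level N T * N / \<Delta>)"
proof -
  let ?b = "path_sum (\<lambda>h x. of_bool (snd x = 0 \<and> bad h))"
  let ?K = "(N + 1) * (log_level N T + 1) + 80000 * log_level N T * N / \<Delta>"
  have "regret F r v \<pi> T \<le> expect T (path_sum (\<lambda>h x. of_bool (snd x = 0) * loss (fst x)))"
    by (rule regret_le_expected_loss)
  also have "\<dots> \<le> expect T (\<lambda>h. (N + 1) * ?b h + N * ?K)"
  proof (intro expectation_mono_finite finite_reachable)
    fix h assume h: "h \<in> reachable T"
    have "(\<Sum>j=1..N. \<Sum>n<epochs_with j h. charge T \<Delta> n) \<le> (\<Sum>j=1..N. ?K)"
      by (intro sum_mono sum_charge_le \<Delta> T)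
    then have "(\<Sum>j=1..N. \<Sum>n<epochs_with j h. charge T \<Delta> n) \<le> N * ?K" by simp
    then show "path_sum (\<lambda>h x. of_bool (snd x = 0) * loss (fst x)) h \<le> (N + 1) * ?b h + N * ?K"
      using path_loss_le[OF h \<Delta>, of T] length_reachable[OF h] unfolding path_sum_charge[OF h] by simp
  qed
  also have "\<dots> = (N + 1) * expect T ?b + N * ?K"
    by (simp add: integrable_trajectory)
  also have "(N + 1) * expect T ?b \<le> (N + 1) * (4 / N)"
    by (intro mult_left_mono expected_bad_le) auto
  \<comment> \<open>The failure bound of order \<open>1 / N\<close> offsets the cost
    \<open>N + 1\<close> of a failed epoch, so the additive constant does not depend on
    \<open>N\<close>.\<close>
  also have "\<dots> \<le> 8" using N by (simp add: field_simps)
  finally show ?thesis by simp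
qed

lemma regret_le_horizon: "regret F r v \<pi> T \<le> T"
proof -
  have "regret F r v \<pi> T \<le> (\<Sum>t=1..T. 1)"
    unfolding regret_def
  proof (rule sum_mono)
    fix t assume t: "t \<in> {1..T}"
    have "0 \<le> expect T (\<lambda>h. revenue r v (offered h t))"
    proof (rule integral_nonneg_AE, unfold AE_measure_pmf_iff, rule ballI)
      fix h assume h: "h \<in> reachable T"
      then have "h ! (t - 1) \<in> set h" using length_reachable[OF h] t by (intro nth_mem) auto
      then have "offered h t \<in> F" using reachable_entries[OF h] by (simp add: offered_def)
      then show "0 \<le> revenue r v (offered h t)" by (rule revenue_nonneg)
    qed
    then show "revenue r v (best_assortment F r v) - expect T (\<lambda>h. revenue r v (offered h t)) \<le> 1"
      using Rstar_le_1 by (simp add: Rstar_def)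
  qed
  then show ?thesis by simp
qed

lemma regret_le_0:
  assumes "\<And>S. S \<in> F \<Longrightarrow> revenue r v S = Rstar"
  shows "regret F r v \<pi> T \<le> 0"
proof -
  have "expect T (path_sum (\<lambda>h x. of_bool (snd x = 0) * loss (fst x))) \<le> expect T (path_sum (\<lambda>_ _. 0))"
    using assms by (intro expect_path_sum_le) (simp add: loss_def)
  also have "path_sum (\<lambda>_ _. 0) = (\<lambda>_. 0)" by (rule ext) (simp add: path_sum_def)
  finally show ?thesis using regret_le_expected_loss[of T] by simp
qed

text \<open>For \<open>T = 1\<close> the logarithm vanishes and the additive constant suffices. For
  \<open>N <= T\<close> the level is of order \<open>ln T\<close>, with
  \<open>400010 = 5 * 80002\<close>. For \<open>N > T\<close> the trivial bound \<open>T\<close> is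
  below \<open>N^2 * 2 * ln T\<close>.\<close>

lemma regret_le_gap:
  assumes T: "T \<ge> 1"
  shows "ereal (regret F r v \<pi> T)
    \<le> ereal 400010 * (ereal (real N ^ 2 * ln (real T)) / gap F r v) + ereal 8"
proof -
  define D where "D = {Rstar - revenue r v S | S. S \<in> F \<and> revenue r v S \<noteq> Rstar}"
  have gap: "gap F r v = (if D = {} then \<infinity> else ereal (Min D))"
    by (simp add: gap_def D_def Rstar_def Let_def)
  show ?thesis
  proof (cases "D = {}")
    case True
    then have "regret F r v \<pi> T \<le> 0" by (intro regret_le_0) (auto simp: D_def)
    \<comment> \<open>Division by the infinite gap gives 0 in \<open>ereal\<close>.\<close>
    then show ?thesis using True by (simp add: gap)
  next
    case False
    define \<Delta> where "\<Delta> = Min D"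
    have fin: "finite D" unfolding D_def using finite_F by simp
    have "\<Delta> \<in> D" using Min_in[OF fin False] by (simp add: \<Delta>_def)
    then obtain S where S: "S \<in> F" "revenue r v S \<noteq> Rstar" "\<Delta> = Rstar - revenue r v S"
      by (auto simp: D_def)
    have \<Delta>: "\<Delta> > 0" "\<Delta> \<le> 1"
      using S best_assortment(2)[of S] revenue_nonneg[of S] Rstar_le_1 by auto
    have \<Delta>_le: "\<Delta> \<le> Rstar - revenue r v S" if "S \<in> F" "revenue r v S \<noteq> Rstar" for S
      unfolding \<Delta>_def using that fin by (intro Min_le) (auto simp: D_def)
    have lnT: "ln T \<ge> 0" using T by simp
    have NN: "real N \<le> real N ^ 2" using N by (simp add: power2_eq_square)
    \<comment> \<open>As \<open>\<Delta> <= 1\<close>, terms without the inverse gap can be absorbed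
      into those with it.\<close>
    have div: "x \<le> x / \<Delta>" if "x \<ge> 0" for x
      using that \<Delta> by (simp add: field_simps mult_left_le_one_le)
    have "regret F r v \<pi> T \<le> 400010 * (real N ^ 2 * ln T / \<Delta>) + 8"
    proof -
      consider "T = 1" | "T \<ge> 2" "N \<le> T" | "T \<ge> 2" "T < N" using T by linarith
      then show ?thesis
      proof cases
        case 1
        then show ?thesis using regret_le_horizon[of T] by simp
      next
        case 2
        define \<Lambda> where "\<Lambda> = log_level N T"
        have \<Lambda>: "\<Lambda> > 0" using log_level_pos[OF N T] by (simp add: \<Lambda>_def)
        have "regret F r v \<pi> T \<le> 8 + N * ((N + 1) * (\<Lambda> + 1) + 80000 * \<Lambda> * N / \<Delta>)"
          using regret_le_log_level[OF T \<Delta>(1) \<Delta>_le] by (simp add: \<Lambda>_def)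
        also have "N * ((N + 1) * (\<Lambda> + 1) + 80000 * \<Lambda> * N / \<Delta>) =
          (real N ^ 2 + N) * (\<Lambda> + 1) + 80000 * (real N ^ 2 * \<Lambda> / \<Delta>)"
          by (simp add: algebra_simps power2_eq_square)
        also have "(real N ^ 2 + N) * (\<Lambda> + 1) \<le> 2 * (real N ^ 2 * (\<Lambda> + 1))"
          using NN \<Lambda> by (simp add: mult_right_mono flip: mult.assoc)
        also have "real N ^ 2 * (\<Lambda> + 1) \<le> real N ^ 2 * (\<Lambda> + 1) / \<Delta>"
          using \<Lambda> by (intro div) simp
        also have "real N ^ 2 * \<Lambda> / \<Delta> \<le> real N ^ 2 * (\<Lambda> + 1) / \<Delta>"
          using \<Delta> by (intro divide_right_mono mult_left_mono) auto
        also have "8 + (2 * (real N ^ 2 * (\<Lambda> + 1) / \<Delta>) + 80000 * (real N ^ 2 * (\<Lambda> + 1) / \<Delta>)) =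
          8 + 80002 * (real N ^ 2 * (\<Lambda> + 1) / \<Delta>)" by simp
        also have "real N ^ 2 * (\<Lambda> + 1) / \<Delta> \<le> real N ^ 2 * (5 * ln T) / \<Delta>"
          using \<Delta> log_level_le_ln[of N T] 2 by (intro divide_right_mono mult_left_mono) (auto simp: \<Lambda>_def)
        finally show ?thesis by simp
      next
        case 3
        have "1 / 2 \<le> ln (real T)"
          using 3 by (intro order_trans[OF ln_2_ge_half]) simp
        then have "real N \<le> real N ^ 2 * (2 * ln T)"
          using NN mult_mono[of "real N" "real N ^ 2" 1 "2 * ln T"] by simp
        also have "\<dots> \<le> real N ^ 2 * (2 * ln T) / \<Delta>" using lnT by (intro div) simp
        also have "\<dots> = 2 * (real N ^ 2 * ln T / \<Delta>)" by simp
        also have "\<dots> \<le> 400010 * (real N ^ 2 * ln T / \<Delta>)" using lnT \<Delta> by (intro mult_right_mono) auto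
        finally show ?thesis using regret_le_horizon[of T] 3 by simp
      qed
    qed
    then show ?thesis using False \<Delta> by (simp add: gap \<Delta>_def)
  qed
qed

end

theorem theorem3:
  shows "\<exists>B1 B2 :: real.
    \<forall>(N::nat) (m::nat) (A :: int mat) (b :: int Matrix.vec) (r :: nat \<Rightarrow> real) (v :: nat \<Rightarrow> real)
      (\<pi> :: policy) (T::nat).
      N \<ge> 1 \<longrightarrow>
      A \<in> carrier_mat m N \<longrightarrow> b \<in> carrier_vec m \<longrightarrow> totally_unimodular A \<longrightarrow>
      (\<forall>S\<in>feasible N A b. \<forall>Q. Q \<subseteq> S \<longrightarrow> Q \<in> feasible N A b) \<longrightarrow>
      (\<forall>i\<in>{1..N}. 0 \<le> r i \<and> r i \<le> 1) \<longrightarrow>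
      v 0 = 1 \<longrightarrow> (\<forall>i\<in>{1..N}. 0 < v i \<and> v i \<le> 1) \<longrightarrow>
      mnl_ucb_policy N (feasible N A b) r \<pi> \<longrightarrow>
      T \<ge> 1 \<longrightarrow>
      ereal (regret (feasible N A b) r v \<pi> T)
        \<le> ereal B1 * (ereal (real N ^ 2 * ln (real T)) / gap (feasible N A b) r v) + ereal B2"
proof (intro exI allI impI)
  fix N m :: nat and A :: "int mat" and b :: "int Matrix.vec" and r v :: "nat \<Rightarrow> real"
    and \<pi> :: policy and T :: nat
  assume *: "N \<ge> 1" "\<forall>S\<in>feasible N A b. \<forall>Q. Q \<subseteq> S \<longrightarrow> Q \<in> feasible N A b"
    "\<forall>i\<in>{1..N}. 0 \<le> r i \<and> r i \<le> 1" "v 0 = 1" "\<forall>i\<in>{1..N}. 0 < v i \<and> v i \<le> 1"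
    "mnl_ucb_policy N (feasible N A b) r \<pi>"
  interpret mnl_ucb N "feasible N A b" r v \<pi>
  proof
    show "S \<subseteq> {1..N}" if "S \<in> feasible N A b" for S
      using that by (simp add: feasible_def)
    show "Q \<in> feasible N A b" if "S \<in> feasible N A b" "Q \<subseteq> S" for S Q
      using *(2)[rule_format, OF that] .
  qed (rule * *(3,5)[rule_format], assumption?)+
  assume "T \<ge> 1"
  then show "ereal (regret (feasible N A b) r v \<pi> T)
    \<le> ereal 400010 * (ereal (real N ^ 2 * ln (real T)) / gap (feasible N A b) r v) + ereal 8"
    by (rule regret_le_gap)
qed

end
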